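(* Let $n\ge m\ge 3$ be integers and let $\Gamma:=\{0,1,\ldots,n-1\}\times\{0,1,\ldots,m-1\}$. Let $G\subset\Gamma$ with ${\rm card}(G)\ge 2$, and assume that $$\max\{|i_1-i_2|,|j_1-j_2|\}\ge 2$$ for every pair of distinct elements $(i_1,j_1),(i_2,j_2)\in G$. Let $(p_{ij})_{(i,j)\in G}$ be a probability vector with $p_{ij}>0$ for all $(i,j)\in G$, and let $\mu$ be the self-affine measure associated with $\{f_{ij}\}_{(i,j)\in G}$ and $(p_{ij})_{(i,j)\in G}$, where $f_{ij}(x,y)=\big(\frac{x+i}{n},\frac{y+j}{m}\big)$. Let $s_0$ be the number defined in the context. Then $$0<\underline{Q}_0^{s_0}(\mu)\le\overline{Q}_0^{s_0}(\mu)<\infty .$$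
   Context: The self-affine measure $\mu$ is the unique Borel probability measure on $\mathbb{R}^2$ with $\mu=\sum_{(i,j)\in G}p_{ij}\,\mu\circ f_{ij}^{-1}$; it is supported on the unique non-empty compact set $E$ with $E=\bigcup_{(i,j)\in G}f_{ij}(E)$ (a Bedford-McMullen carpet). Let $\vartheta:=\frac{\log m}{\log n}$, $G_y:=\{j:(i,j)\in G\text{ for some }i\}$, $G_x(j):=\{i:(i,j)\in G\}$ and $q_j:=\sum_{i\in G_x(j)}p_{ij}$ for $j\in G_y$. Define $$s_0:=-\frac{1}{\log m}\Big(\vartheta\sum_{(i,j)\in G}p_{ij}\log p_{ij}+(1-\vartheta)\sum_{j\in G_y}q_j\log q_j\Big).$$ For a Borel probability measure $\nu$ on $\mathbb{R}^2$ and $k\in\mathbb{N}$, the $k$th geometric mean error is $$e_{k}(\nu)=e_{k,0}(\nu):=\inf\Big\{\exp\Big(\int\log d(x,\alpha)\,d\nu(x)\Big):\alpha\subset\mathbb{R}^2,\ 1\le{\rm card}(\alpha)\le k\Big\},$$ where $d(x,\alpha)$ is the Euclidean distance from $x$ to $\alpha$. For $s>0$, the $s$-dimensional upper and lower quantization coefficients of order zero are $$\overline{Q}_0^s(\nu):=\limsup_{k\to\infty}k^{1/s}e_k(\nu),\qquad \underline{Q}_0^s(\nu):=\liminf_{k\to\infty}k^{1/s}e_k(\nu).$$ *)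

theory Defs
  imports "HOL-Analysis.Analysis" "HOL-Probability.Probability_Measure"
begin

text \<open>
  The plane is \<^typ>\<open>real \<times> real\<close>, whose library metric is the Euclidean one.
\<close>

definition digit_map :: "nat \<Rightarrow> nat \<Rightarrow> nat \<Rightarrow> nat \<Rightarrow> real \<times> real \<Rightarrow> real \<times> real" where
  "digit_map n m i j = (\<lambda>(x, y). ((x + real i) / real n, (y + real j) / real m))"

text \<open>
  By Hutchinson's theorem exactly one measure satisfies this predicate when the digit set is
  a finite non-empty set, \<open>n, m \<ge> 2\<close> and \<open>p\<close> is a probability vector on it.
\<close>

definition self_affine_measure ::
    "nat \<Rightarrow> nat \<Rightarrow> (nat \<times> nat) set \<Rightarrow> (nat \<Rightarrow> nat \<Rightarrow> real) \<Rightarrow> (real \<times> real) measure \<Rightarrow> bool" where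
  "self_affine_measure n m G p \<mu> \<longleftrightarrow>
     prob_space \<mu> \<and> sets \<mu> = sets borel \<and>
     (\<forall>A \<in> sets borel.
        measure \<mu> A = (\<Sum>(i, j)\<in>G. p i j * measure (distr \<mu> borel (digit_map n m i j)) A))"

definition rows :: "(nat \<times> nat) set \<Rightarrow> nat set" where
  "rows G = {j. \<exists>i. (i, j) \<in> G}"

definition row_digits :: "(nat \<times> nat) set \<Rightarrow> nat \<Rightarrow> nat set" where
  "row_digits G j = {i. (i, j) \<in> G}"

definition row_weight :: "(nat \<times> nat) set \<Rightarrow> (nat \<Rightarrow> nat \<Rightarrow> real) \<Rightarrow> nat \<Rightarrow> real" where
  "row_weight G p j = (\<Sum>i\<in>row_digits G j. p i j)"

definition carpet_exponent :: "nat \<Rightarrow> nat \<Rightarrow> real" where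
  "carpet_exponent n m = ln (real m) / ln (real n)"

definition carpet_dim ::
    "nat \<Rightarrow> nat \<Rightarrow> (nat \<times> nat) set \<Rightarrow> (nat \<Rightarrow> nat \<Rightarrow> real) \<Rightarrow> real" where
  "carpet_dim n m G p =
     - (1 / ln (real m)) *
       (carpet_exponent n m * (\<Sum>(i, j)\<in>G. p i j * ln (p i j)) +
        (1 - carpet_exponent n m) * (\<Sum>j\<in>rows G. row_weight G p j * ln (row_weight G p j)))"

text \<open>
  The logarithm of the distance to \<open>\<alpha>\<close> is \<open>-\<infinity>\<close> on \<open>\<alpha>\<close>, and for a general measure its integral
  may be infinite. The Bochner integral and the real logarithm give \<open>0\<close> in these cases, so the
  integral is taken in \<^typ>\<open>ereal\<close> as positive part minus negative part (\<^const>\<open>e2ennreal\<close>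
  maps negative numbers to \<open>0\<close>), with \<open>exp (-\<infinity>) = 0\<close> and \<open>exp \<infinity> = \<infinity>\<close>. If both
  parts are infinite, so that the integral is undefined, the value is \<open>\<infinity>\<close> and such an \<open>\<alpha>\<close>
  does not contribute to the infimum.
\<close>

definition log_ereal :: "real \<Rightarrow> ereal" where
  "log_ereal t = (if t \<le> 0 then -\<infinity> else ereal (ln t))"

definition exp_ereal :: "ereal \<Rightarrow> ereal" where
  "exp_ereal x = (if x = \<infinity> then \<infinity> else if x = -\<infinity> then 0 else ereal (exp (real_of_ereal x)))"

definition log_dist_integral :: "(real \<times> real) measure \<Rightarrow> (real \<times> real) set \<Rightarrow> ereal" where
  "log_dist_integral \<nu> \<alpha> =
     enn2ereal (\<integral>\<^sup>+ x. e2ennreal (log_ereal (infdist x \<alpha>)) \<partial>\<nu>) -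
     enn2ereal (\<integral>\<^sup>+ x. e2ennreal (- log_ereal (infdist x \<alpha>)) \<partial>\<nu>)"

definition geom_mean_error :: "nat \<Rightarrow> (real \<times> real) measure \<Rightarrow> ereal" where
  "geom_mean_error k \<nu> =
     Inf {exp_ereal (log_dist_integral \<nu> \<alpha>) | \<alpha>. finite \<alpha> \<and> 1 \<le> card \<alpha> \<and> card \<alpha> \<le> k}"

definition upper_quantization_coeff :: "real \<Rightarrow> (real \<times> real) measure \<Rightarrow> ereal" where
  "upper_quantization_coeff s \<nu> =
     limsup (\<lambda>k. ereal (real k powr (1 / s)) * geom_mean_error k \<nu>)"

definition lower_quantization_coeff :: "real \<Rightarrow> (real \<times> real) measure \<Rightarrow> ereal" where
  "lower_quantization_coeff s \<nu> =
     liminf (\<lambda>k. ereal (real k powr (1 / s)) * geom_mean_error k \<nu>)"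

end

theory Submission
  imports Defs
begin

text \<open>
  Approximate squares of level \<open>k\<close> have side \<open>m\<^sup>-\<^sup>k\<close> up to a constant and are coded by the first
  \<open>lev k = \<lfloor>\<theta> k\<rfloor>\<close> digit pairs and the next \<open>k - lev k\<close> row digits of a word. Let \<open>V k\<close> be minus the
  logarithm of the mass of the square of level \<open>k\<close> containing a random word, and call the square
  heavy if \<open>V k \<le> T\<close>. Both bounds reduce to the expected number of heavy levels.

  Since \<open>V\<close> grows at least linearly, there are at most \<open>C exp T\<close> heavy squares over all levels
  together. The corners of these squares form a nearly optimal set. Conversely, let \<open>\<alpha>\<close> have at
  most \<open>exp T\<close> points. The light squares that lie near \<open>\<alpha>\<close> at their own scale have bounded total
  mass: those with a heavy neighbour are charged to that neighbour, and if all squares near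
  \<open>a \<in> \<alpha>\<close> are light at some level, the masses near \<open>a\<close> decay geometrically from there on.

  The number of heavy levels is not a stopping time for the sequence of digit pairs, because the
  squares do not reveal the pairs in order, so Wald's identity is not available. However,
  resampling one digit changes \<open>V k\<close> by at most a constant, hence affects the event \<open>V k \<le> T\<close> only
  when \<open>V k\<close> is close to \<open>T\<close>, which happens for a bounded number of levels. So Wald's identity
  holds up to a constant, and the expected number of heavy levels is \<open>T / (s\<^sub>0 log m) + O(1)\<close>.
\<close>

section \<open>Averages over words\<close>

locale weighted_alphabet =
  fixes G :: "'a set" and P :: "'a \<Rightarrow> real"
  assumes fin: "finite G" and P_pos: "g \<in> G \<Longrightarrow> 0 < P g" and P_sum: "sum P G = 1"
begin

definition words :: "nat \<Rightarrow> 'a list set" where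
  "words L = {w. length w = L \<and> set w \<subseteq> G}"

text \<open>Expectation of \<open>F\<close> for \<open>L\<close> independent letters of law
  \<open>P\<close>, built letter by letter as a finite sum in place of an integral over a product
  measure.\<close>

primrec avg :: "nat \<Rightarrow> ('a list \<Rightarrow> real) \<Rightarrow> real" where
  "avg 0 F = F []"
| "avg (Suc L) F = (\<Sum>g\<in>G. P g * avg L (\<lambda>w. F (g # w)))"

lemma words_Suc_iff: "w \<in> words (Suc L) \<longleftrightarrow> (\<exists>g v. w = g # v \<and> g \<in> G \<and> v \<in> words L)"
  by (cases w) (auto simp: words_def)

lemma nth_words: "w \<in> words L \<Longrightarrow> h < L \<Longrightarrow> w ! h \<in> G"
  by (auto simp: words_def)

lemma finite_words: "finite (words L)"
  using finite_lists_length_eq[OF fin, of L] by (simp add: words_def conj_commute)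

lemma avg_mono:
  "(\<And>w. w \<in> words L \<Longrightarrow> F w \<le> F' w) \<Longrightarrow> avg L F \<le> avg L F'"
proof (induction L arbitrary: F F')
  case 0
  then show ?case by (simp add: words_def)
next
  case (Suc L)
  have "avg L (\<lambda>w. F (g # w)) \<le> avg L (\<lambda>w. F' (g # w))" if "g \<in> G" for g
    by (rule Suc.IH) (use that Suc.prems in \<open>auto simp: words_Suc_iff\<close>)
  then have "P g * avg L (\<lambda>w. F (g # w)) \<le> P g * avg L (\<lambda>w. F' (g # w))" if "g \<in> G" for g
    using P_pos[OF that] that by (intro mult_left_mono) auto
  then show ?case
    by (auto intro: sum_mono)
qed

lemma avg_cong:
  "(\<And>w. w \<in> words L \<Longrightarrow> F w = F' w) \<Longrightarrow> avg L F = avg L F'"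
  by (intro antisym avg_mono) auto

lemma avg_const [simp]: "avg L (\<lambda>_. c) = c"
  by (induction L) (auto simp: P_sum simp flip: sum_distrib_right)

lemma avg_add: "avg L (\<lambda>w. F w + F' w) = avg L F + avg L F'"
  by (induction L arbitrary: F F') (auto simp: sum.distrib algebra_simps)

lemma avg_cmult: "avg L (\<lambda>w. c * F w) = c * avg L F"
  by (induction L arbitrary: F) (auto simp: sum_distrib_left algebra_simps)

lemma avg_sum: "avg L (\<lambda>w. \<Sum>x\<in>A. F x w) = (\<Sum>x\<in>A. avg L (F x))"
proof (induction A rule: infinite_finite_induct)
  case (insert x A)
  then show ?case by (simp add: avg_add)
qed auto

lemma avg_diff: "avg L (\<lambda>w. F w - F' w) = avg L F - avg L F'"
  using avg_add[of L F "\<lambda>w. -1 * F' w"] avg_cmult[of L "-1" F'] by simp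

lemma abs_avg_le:
  assumes "\<And>w. w \<in> words L \<Longrightarrow> \<bar>F w\<bar> \<le> F' w"
  shows "\<bar>avg L F\<bar> \<le> avg L F'"
proof -
  have "avg L F \<le> avg L F'" "avg L (\<lambda>w. 0 - F w) \<le> avg L F'"
    by (rule avg_mono; use assms in \<open>force simp: abs_le_iff\<close>)+
  then show ?thesis by (simp only: avg_diff avg_const abs_le_iff) simp
qed

text \<open>Independence and equal distribution of the letters: replacing letter \<open>h\<close> by
  a fresh copy preserves the law of the word.\<close>

lemma avg_resample:
  "h < L \<Longrightarrow> avg L (\<lambda>w. \<Sum>g\<in>G. P g * F (w[h := g])) = avg L F"
proof (induction L arbitrary: h F)
  case 0
  then show ?case by simp
next
  case (Suc L)
  show ?case
  proof (cases h)
    case 0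
    have "avg (Suc L) (\<lambda>w. \<Sum>g\<in>G. P g * F (w[h := g])) =
        (\<Sum>g'\<in>G. P g' * (\<Sum>g\<in>G. P g * avg L (\<lambda>w. F (g # w))))"
      by (simp only: 0 avg.simps list_update_code) (simp only: avg_sum avg_cmult)
    also have "\<dots> = (\<Sum>g'\<in>G. P g') * (\<Sum>g\<in>G. P g * avg L (\<lambda>w. F (g # w)))"
      by (rule sum_distrib_right [symmetric])
    also have "\<dots> = avg (Suc L) F"
      by (simp add: P_sum)
    finally show ?thesis .
  next
    case (Suc h')
    then have "h' < L" using Suc.prems by simp
    then have "avg L (\<lambda>w. \<Sum>g\<in>G. P g * F (g' # w[h' := g])) = avg L (\<lambda>w. F (g' # w))" for g'
      using Suc.IH[of h' "\<lambda>w. F (g' # w)"] by simp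
    then show ?thesis using Suc by simp
  qed
qed

lemma avg_indicator_le_card:
  assumes "finite S" "\<And>c. c \<in> S \<Longrightarrow> avg L (\<lambda>w. of_bool (f w = c)) \<le> x"
  shows "avg L (\<lambda>w. of_bool (f w \<in> S)) \<le> real (card S) * x"
proof -
  have "avg L (\<lambda>w. of_bool (f w \<in> S)) = (\<Sum>c\<in>S. avg L (\<lambda>w. of_bool (f w = c)))"
    using assms(1) by (simp add: of_bool_def flip: avg_sum)
  also have "\<dots> \<le> real (card S) * x"
    using assms(2) by (rule sum_bounded_above)
  finally show ?thesis .
qed

end

section \<open>Masses of approximate squares\<close>

lemma geometric_sum_le:
  fixes x :: real
  assumes "0 \<le> x" "x < 1"
  shows "(\<Sum>i<N. x ^ i) \<le> 1 / (1 - x)"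
proof -
  have "(\<Sum>i<N. x ^ i) \<le> (\<Sum>i. x ^ i)"
    using assms by (intro sum_le_suminf summable_geometric) auto
  then show ?thesis using assms by (simp add: suminf_geometric)
qed

lemma down_closed_eq_lessThan:
  fixes M :: nat
  assumes "\<And>j k. j \<le> k \<Longrightarrow> k < M \<Longrightarrow> Q k \<Longrightarrow> Q j"
  obtains K where "K \<le> M" "\<And>k. k < M \<Longrightarrow> Q k \<longleftrightarrow> k < K"
proof -
  have "\<exists>K\<le>M. \<forall>k<M. Q k \<longleftrightarrow> k < K"
  proof (cases "\<forall>k<M. Q k")
    case True
    then show ?thesis by blast
  next
    case False
    then obtain k where k: "k < M \<and> \<not> Q k" by blast
    define K where "K = (LEAST k. k < M \<and> \<not> Q k)"
    have K: "K < M \<and> \<not> Q K" unfolding K_def using k by (rule LeastI)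
    have less: "Q j" if "j < K" for j
      using not_less_Least[of j "\<lambda>k. k < M \<and> \<not> Q k"] that K unfolding K_def by linarith
    have "Q k \<longleftrightarrow> k < K" if "k < M" for k
    proof
      assume "Q k"
      then show "k < K" using assms[of K k] K that by (meson not_le)
    qed (rule less)
    then show ?thesis using K less_imp_le by blast
  qed
  then show thesis using that by blast
qed

locale carpet =
  fixes n m :: nat and G :: "(nat \<times> nat) set" and P :: "nat \<times> nat \<Rightarrow> real"
  assumes m_ge: "2 \<le> m" and n_ge: "m \<le> n"
    and G_digits: "G \<subseteq> {..<n} \<times> {..<m}"
    and card_G: "2 \<le> card G"
    and P_pos': "g \<in> G \<Longrightarrow> 0 < P g"
    and P_sum': "sum P G = 1"
begin

sublocale weighted_alphabet G P
  using card_G P_pos' P_sum' by unfold_locales (auto intro: card_ge_0_finite)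

definition row_mass :: "nat \<Rightarrow> real" where
  "row_mass j = (\<Sum>g\<in>{g \<in> G. snd g = j}. P g)"

definition theta :: real where "theta = ln (real m) / ln (real n)"

definition lev :: "nat \<Rightarrow> nat" where "lev k = nat \<lfloor>theta * real k\<rfloor>"

definition cell_info :: "nat \<times> nat \<Rightarrow> real" where
  "cell_info g = - ln (P g)"

definition row_info :: "nat \<times> nat \<Rightarrow> real" where
  "row_info g = - ln (row_mass (snd g))"

text \<open>Letters before \<open>lev k\<close> are known completely and carry
  \<open>cell_info\<close>; the later ones are known only by their row and carry
  \<open>row_info\<close>. Writing the former as \<open>row_info\<close> plus a correction makes the
  increment in \<open>k\<close> explicit.\<close>

definition V :: "nat \<Rightarrow> (nat \<times> nat) list \<Rightarrow> real" where
  "V k w = (\<Sum>h<k. row_info (w ! h)) + (\<Sum>h<lev k. cell_info (w ! h) - row_info (w ! h))"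

definition max_info :: real where "max_info = Max (cell_info ` G)"

definition cell_entropy :: real where "cell_entropy = (\<Sum>g\<in>G. P g * cell_info g)"

definition row_entropy :: real where "row_entropy = (\<Sum>g\<in>G. P g * row_info g)"

text \<open>Mean growth of \<open>V\<close> per level; it equals \<open>carpet_dim\<close> times
  \<open>ln m\<close>.\<close>

definition entropy_rate :: real where
  "entropy_rate = theta * cell_entropy + (1 - theta) * row_entropy"

section \<open>The level function and the two scales of an approximate square\<close>

lemma ln_m_pos: "0 < ln (real m)" and ln_n_pos: "0 < ln (real n)"
  using m_ge n_ge by auto

lemma theta_pos: "0 < theta"
  using ln_m_pos ln_n_pos by (simp add: theta_def)

lemma theta_le: "theta \<le> 1"
  using ln_n_pos m_ge n_ge by (simp add: theta_def)

lemma lev_0 [simp]: "lev 0 = 0"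
  by (simp add: lev_def)

lemma lev_upper: "real (lev k) \<le> theta * real k"
  unfolding lev_def using theta_pos by simp

lemma lev_lower: "theta * real k - 1 < real (lev k)"
  unfolding lev_def by linarith

lemma lev_mono: "j \<le> k \<Longrightarrow> lev j \<le> lev k"
  unfolding lev_def using theta_pos by (intro nat_mono floor_mono mult_left_mono) auto

lemma lev_le: "lev k \<le> k"
proof -
  have "theta * real k \<le> 1 * real k"
    using theta_le by (intro mult_right_mono) auto
  with lev_upper[of k] show ?thesis by linarith
qed

text \<open>As \<open>theta \<le> 1\<close>, the floor advances by at most one, so one level
  completes at most one letter.\<close>

lemma lev_Suc: "lev (Suc k) = lev k \<or> lev (Suc k) = Suc (lev k)"
proof -
  have "real (lev (Suc k)) \<le> theta * real k + theta"
    using lev_upper[of "Suc k"] by (simp add: algebra_simps)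
  then have "real (lev (Suc k)) < real (lev k) + 2"
    using lev_lower[of k] theta_le by linarith
  moreover have "lev k \<le> lev (Suc k)" by (rule lev_mono) simp
  ultimately show ?thesis by linarith
qed

lemma powr_theta: "real n powr theta = real m"
  using ln_m_pos ln_n_pos m_ge n_ge by (simp add: powr_def theta_def)

lemma n_lev_le: "real n ^ lev k \<le> real m ^ k"
proof -
  have "real n ^ lev k = real n powr real (lev k)"
    using m_ge n_ge by (simp add: powr_realpow)
  also have "\<dots> \<le> real n powr (theta * real k)"
    using m_ge n_ge lev_upper by (intro powr_mono) auto
  also have "\<dots> = real m ^ k"
    using m_ge n_ge by (simp add: powr_powr[symmetric] powr_theta powr_realpow)
  finally show ?thesis .
qed

text \<open>The floor costs at most one power of \<open>n\<close>; with \<open>n_lev_le\<close>,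
  width and height of an approximate square agree up to the factor \<open>n\<close>.\<close>

lemma m_pow_le: "real m ^ k \<le> real n * real n ^ lev k"
proof -
  have "real m ^ k = real n powr (theta * real k)"
    using m_ge n_ge by (simp add: powr_powr[symmetric] powr_theta powr_realpow)
  also have "\<dots> \<le> real n powr real (Suc (lev k))"
    using m_ge n_ge lev_lower[of k] by (intro powr_mono) auto
  also have "\<dots> = real n * real n ^ lev k"
    using m_ge n_ge by (simp add: powr_realpow powr_add)
  finally show ?thesis .
qed

section \<open>Information carried by a single letter\<close>

lemma P_le_row_mass: "g \<in> G \<Longrightarrow> P g \<le> row_mass (snd g)"
  unfolding row_mass_def using fin P_pos by (intro member_le_sum) (auto intro: less_imp_le)

lemma row_mass_pos: "g \<in> G \<Longrightarrow> 0 < row_mass (snd g)"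
  using P_pos P_le_row_mass by (meson less_le_trans)

lemma row_mass_le: "row_mass j \<le> 1"
proof -
  have "row_mass j \<le> sum P G"
    unfolding row_mass_def using fin P_pos by (intro sum_mono2) (auto intro: less_imp_le)
  then show ?thesis by (simp add: P_sum)
qed

lemma P_less: "g \<in> G \<Longrightarrow> P g < 1"
proof -
  assume g: "g \<in> G"
  have "G - {g} \<noteq> {}"
  proof
    assume "G - {g} = {}"
    then have "card G \<le> card {g}" by (intro card_mono) auto
    with card_G show False by simp
  qed
  then have "0 < sum P (G - {g})" using fin P_pos by (intro sum_pos) auto
  then show ?thesis using sum.remove[OF fin g, of P] P_sum by simp
qed

lemma row_info_nonneg: "g \<in> G \<Longrightarrow> 0 \<le> row_info g"
  using row_mass_pos row_mass_le by (auto simp: row_info_def)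

lemma row_info_le: "g \<in> G \<Longrightarrow> row_info g \<le> cell_info g"
  using P_pos P_le_row_mass row_mass_pos by (simp add: row_info_def cell_info_def)

lemma cell_info_pos: "g \<in> G \<Longrightarrow> 0 < cell_info g"
  using P_pos P_less by (simp add: cell_info_def)

lemma cell_info_le: "g \<in> G \<Longrightarrow> cell_info g \<le> max_info"
  unfolding max_info_def using fin by (intro Max_ge) auto

lemma max_info_pos: "0 < max_info"
proof -
  obtain g where "g \<in> G" using card_G by (metis all_not_in_conv card.empty not_numeral_le_zero)
  then show ?thesis using cell_info_pos cell_info_le by (meson less_le_trans)
qed

section \<open>Growth of \<open>V\<close> along a word\<close>

lemma V_0 [simp]: "V 0 w = 0"
  by (simp add: V_def)

text \<open>Level \<open>k + 1\<close> reveals the row of letter \<open>k\<close> and, when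
  \<open>lev\<close> advances, also the column of the letter \<open>lev k\<close>, which may lie
  much earlier in the word.\<close>

lemma V_Suc:
  "V (Suc k) w = V k w + row_info (w ! k) +
     (if lev (Suc k) = Suc (lev k) then cell_info (w ! lev k) - row_info (w ! lev k) else 0)"
  using lev_Suc[of k] by (auto simp: V_def)

lemma V_increment:
  assumes "w \<in> words M" "k < M"
  shows "V k w \<le> V (Suc k) w" "V (Suc k) w \<le> V k w + 2 * max_info"
proof -
  have 1: "w ! k \<in> G" and 2: "w ! lev k \<in> G"
    using assms lev_le[of k] by (auto intro!: nth_words)
  show "V k w \<le> V (Suc k) w" "V (Suc k) w \<le> V k w + 2 * max_info"
    unfolding V_Suc using row_info_nonneg[OF 1] row_info_le[OF 1] cell_info_le[OF 1]
      row_info_nonneg[OF 2] row_info_le[OF 2] cell_info_le[OF 2] by auto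
qed

text \<open>Exactly when all digits lie in a single row, the row information vanishes, and only the
  steps of \<^term>\<open>lev\<close> contribute; in all other cases it is bounded below.\<close>

lemma V_growth_exists:
  "\<exists>d>0. \<forall>M w k k'. w \<in> words M \<longrightarrow> k \<le> k' \<longrightarrow> k' \<le> M \<longrightarrow>
     V k w + d * theta * real (k' - k) - d \<le> V k' w"
proof (cases "\<forall>g\<in>G. 0 < row_info g")
  case True
  define d where "d = Min (row_info ` G)"
  have ne: "G \<noteq> {}" using card_G by auto
  then have d: "0 < d" unfolding d_def using True fin by simp
  have increment: "V k w + d \<le> V (Suc k) w" if "w \<in> words M" "k < M" for w M k
  proof -
    have 1: "w ! k \<in> G" and 2: "w ! lev k \<in> G"
      using that lev_le[of k] by (auto intro!: nth_words)
    have "d \<le> row_info (w ! k)" unfolding d_def using 1 fin by (intro Min_le) auto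
    then show ?thesis unfolding V_Suc using row_info_le[OF 2] by auto
  qed
  have "V k w + d * real (k' - k) \<le> V k' w" if "w \<in> words M" "k \<le> k'" "k' \<le> M" for w M k k'
    using that(2,3)
  proof (induction k' rule: dec_induct)
    case (step i)
    then show ?case
      using increment[OF that(1), of i]
      by (simp add: Suc_diff_le algebra_simps)
  qed simp
  \<comment> \<open>This case has the stronger growth \<open>d * (k' - k)\<close>; it is weakened to
    the form shared with the one-row case.\<close>
  moreover have "d * theta * real (k' - k) \<le> d * real (k' - k)" for k k' :: nat
    using d theta_le theta_pos by (intro mult_right_mono) auto
  ultimately show ?thesis using d by (smt (verit))
next
  case False
  then obtain g0 where g0: "g0 \<in> G" "row_info g0 = 0"
    using row_info_nonneg by (metis antisym_conv1 order_less_le)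
  define j where "j = snd g0"
  \<comment> \<open>Zero row information means that row \<open>j\<close> has full mass, which
    excludes digits in other rows because all weights are positive.\<close>
  have "row_mass j = 1"
    using g0 row_mass_pos[OF g0(1)] by (simp add: row_info_def j_def)
  then have "sum P {g \<in> G. snd g = j} = sum P G" by (simp add: row_mass_def P_sum)
  moreover have "sum P G = sum P {g \<in> G. snd g = j} + sum P {g \<in> G. snd g \<noteq> j}"
    using fin by (subst sum.union_disjoint[symmetric]) (auto intro: sum.cong)
  ultimately have z: "sum P {g \<in> G. snd g \<noteq> j} = 0" by simp
  have "{g \<in> G. snd g \<noteq> j} = {}"
  proof (rule ccontr)
    assume "{g \<in> G. snd g \<noteq> j} \<noteq> {}"
    then have "0 < sum P {g \<in> G. snd g \<noteq> j}" using fin P_pos by (intro sum_pos) auto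
    with z show False by simp
  qed
  then have r0: "row_info g = 0" if "g \<in> G" for g
  proof -
    have "snd g = j" using that \<open>{g \<in> G. snd g \<noteq> j} = {}\<close> by blast
    then show ?thesis using \<open>row_mass j = 1\<close> by (simp add: row_info_def)
  qed
  define d where "d = Min (cell_info ` G)"
  have ne: "G \<noteq> {}" using card_G by auto
  then have d: "0 < d" unfolding d_def using cell_info_pos fin by simp
  have increment: "V k w + d * (real (lev (Suc k)) - real (lev k)) \<le> V (Suc k) w"
    if "w \<in> words M" "k < M" for w M k
  proof -
    have 1: "w ! k \<in> G" and 2: "w ! lev k \<in> G"
      using that lev_le[of k] by (auto intro!: nth_words)
    have "d \<le> cell_info (w ! lev k)" unfolding d_def using 2 fin by (intro Min_le) auto
    then show ?thesis unfolding V_Suc using r0[OF 1] r0[OF 2] lev_Suc[of k] by auto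
  qed
  have "V k w + d * (real (lev k') - real (lev k)) \<le> V k' w"
    if "w \<in> words M" "k \<le> k'" "k' \<le> M" for w M k k'
    using that(2,3)
  proof (induction k' rule: dec_induct)
    case (step i)
    then show ?case
      using increment[OF that(1), of i]
      by (simp add: algebra_simps)
  qed simp
  \<comment> \<open>Only steps of \<open>lev\<close> add information here, and the floor can hide
    almost one step; hence the subtracted \<open>d\<close>.\<close>
  moreover have "d * theta * real (k' - k) - d \<le> d * (real (lev k') - real (lev k))"
    if "k \<le> k'" for k k' :: nat
  proof -
    have "theta * (real k' - real k) - 1 \<le> real (lev k') - real (lev k)"
      using lev_lower[of k'] lev_upper[of k] by (simp add: algebra_simps)
    then have "d * (theta * (real k' - real k) - 1) \<le> d * (real (lev k') - real (lev k))"
      using d by (intro mult_left_mono) auto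
    then show ?thesis using that by (simp add: algebra_simps of_nat_diff)
  qed
  ultimately show ?thesis using d by (smt (verit))
qed

text \<open>A growth constant fixed once, independent of the word, its length and the levels, so
  that all later constants are uniform.\<close>

definition gap :: real where
  "gap = (SOME d. 0 < d \<and> (\<forall>M w k k'. w \<in> words M \<longrightarrow> k \<le> k' \<longrightarrow> k' \<le> M \<longrightarrow>
     V k w + d * theta * real (k' - k) - d \<le> V k' w))"

definition slope :: real where "slope = gap * theta"

lemma gap_pos: "0 < gap"
  and V_growth: "w \<in> words M \<Longrightarrow> k \<le> k' \<Longrightarrow> k' \<le> M \<Longrightarrow>
    V k w + slope * real (k' - k) - gap \<le> V k' w"
proof -
  have "0 < gap \<and> (\<forall>M w k k'. w \<in> words M \<longrightarrow> k \<le> k' \<longrightarrow> k' \<le> M \<longrightarrow>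
     V k w + gap * theta * real (k' - k) - gap \<le> V k' w)"
    unfolding gap_def by (rule someI_ex) (use V_growth_exists in auto)
  then show "0 < gap" "w \<in> words M \<Longrightarrow> k \<le> k' \<Longrightarrow> k' \<le> M \<Longrightarrow>
    V k w + slope * real (k' - k) - gap \<le> V k' w" by (auto simp: slope_def)
qed

lemma slope_pos: "0 < slope"
  using gap_pos theta_pos by (simp add: slope_def)

lemma V_mono:
  assumes "w \<in> words M" "k \<le> k'" "k' \<le> M"
  shows "V k w \<le> V k' w"
  using assms(2,3)
proof (induction k' rule: dec_induct)
  case (step i)
  then show ?case using V_increment(1)[OF assms(1), of i] by simp
qed simp

end

section \<open>The expected number of heavy levels\<close>

context carpet
begin

text \<open>Monotonicity of \<open>V\<close> makes the heavy levels an initial segment;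
  \<open>K\<close> is the first light level, or \<open>M\<close>.\<close>

lemma light_prefix:
  assumes "w \<in> words M"
  obtains K where "K \<le> M" "\<And>k. k < M \<Longrightarrow> V k w \<le> T \<longleftrightarrow> k < K"
proof (rule down_closed_eq_lessThan[of M "\<lambda>k. V k w \<le> T"])
  fix j k assume "j \<le> k" "k < M" "V k w \<le> T"
  then show "V j w \<le> T" using V_mono[OF assms, of j k] by linarith
qed (use that in blast)

text \<open>Linear growth carries \<open>V\<close> across any window of width \<open>2 * c\<close>
  in a number of levels independent of \<open>M\<close>, \<open>w\<close> and
  \<open>T\<close>.\<close>

lemma V_window_count:
  assumes w: "w \<in> words M" and c: "0 \<le> c"
  shows "(\<Sum>k<M. of_bool (\<bar>V k w - T\<bar> \<le> c)) \<le> (2 * c + gap) / slope + 1"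
proof -
  define S where "S = {k. k < M \<and> \<bar>V k w - T\<bar> \<le> c}"
  have fS: "finite S" by (simp add: S_def)
  have eq: "(\<Sum>k<M. of_bool (\<bar>V k w - T\<bar> \<le> c)) = real (card S)"
    by (simp add: S_def Int_def lessThan_def)
  show ?thesis
  proof (cases "S = {}")
    case True
    then show ?thesis unfolding eq using c gap_pos slope_pos by simp
  next
    case False
    define a where "a = Min S"
    define b where "b = Max S"
    have ab: "a \<in> S" "b \<in> S" "a \<le> b"
      unfolding a_def b_def using False fS by (auto simp: Min_le_iff)
    have "V a w + slope * real (b - a) - gap \<le> V b w"
      using ab by (intro V_growth[OF w]) (auto simp: S_def)
    then have "slope * real (b - a) \<le> 2 * c + gap"
      using ab by (auto simp: S_def abs_le_iff)
    then have "real (b - a) \<le> (2 * c + gap) / slope"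
      using slope_pos by (simp add: field_simps)
    moreover have "card S \<le> card {a..b}"
      using fS by (intro card_mono) (auto simp: a_def b_def)
    ultimately show ?thesis unfolding eq using ab(3) by simp
  qed
qed

text \<open>Value of the geometric series of ratio \<open>exp (- slope)\<close>, inflated by the
  loss \<open>gap\<close> in \<open>V_growth\<close>.\<close>

definition heavy_const :: real where "heavy_const = exp gap / (1 - exp (- slope))"

lemma heavy_const_ge_1: "1 \<le> heavy_const"
proof -
  have "1 - exp (- slope) \<le> exp gap" using gap_pos by (smt (verit) exp_gt_zero one_le_exp_iff)
  then show ?thesis using slope_pos by (simp add: heavy_const_def)
qed

text \<open>Read backwards from the last heavy level, where \<open>V \<le> T\<close>, the terms
  decay geometrically. The average of this sum will be the number of heavy squares.\<close>

lemma sum_exp_V_le: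
  assumes w: "w \<in> words M"
  shows "(\<Sum>k<M. of_bool (V k w \<le> T) * exp (V k w)) \<le> heavy_const * exp T"
proof -
  obtain K where K: "K \<le> M" "\<And>k. k < M \<Longrightarrow> V k w \<le> T \<longleftrightarrow> k < K"
    using light_prefix[OF w] by blast
  have "(\<Sum>k<M. of_bool (V k w \<le> T) * exp (V k w)) = (\<Sum>k<K. exp (V k w))"
    using K by (intro sum.mono_neutral_cong_right) auto
  also have "\<dots> \<le> (\<Sum>k<K. exp (T + gap) * exp (- slope) ^ (K - Suc k))"
  proof (intro sum_mono)
    fix k assume k: "k \<in> {..<K}"
    have "V k w + slope * real (K - 1 - k) - gap \<le> V (K - 1) w"
      using k K by (intro V_growth[OF w]) auto
    moreover have "V (K - 1) w \<le> T" using K(2)[of "K - 1"] K(1) k by auto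
    ultimately have "V k w \<le> (T + gap) + real (K - Suc k) * (- slope)"
      by (simp add: algebra_simps)
    then have "exp (V k w) \<le> exp ((T + gap) + real (K - Suc k) * (- slope))" by simp
    also have "\<dots> = exp (T + gap) * exp (- slope) ^ (K - Suc k)"
      by (simp only: exp_add exp_of_nat_mult)
    finally show "exp (V k w) \<le> exp (T + gap) * exp (- slope) ^ (K - Suc k)" .
  qed
  also have "\<dots> = exp (T + gap) * (\<Sum>k<K. exp (- slope) ^ k)"
    by (simp add: sum.nat_diff_reindex flip: sum_distrib_left)
  also have "\<dots> \<le> exp (T + gap) * (1 / (1 - exp (- slope)))"
    using slope_pos by (intro mult_left_mono geometric_sum_le) auto
  also have "\<dots> = heavy_const * exp T"
    by (simp add: heavy_const_def exp_add)
  finally show ?thesis .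
qed

section \<open>Decoupling a letter from heaviness\<close>

lemma V_update:
  assumes w: "w \<in> words M" and g: "g \<in> G" and "h < M" "k \<le> M"
  shows "\<bar>V k (w[h := g]) - V k w\<bar> \<le> max_info"
proof -
  \<comment> \<open>\<open>u h g\<close> is the whole contribution of letter \<open>g\<close> at
    position \<open>h\<close>, so an update alters a single summand with values in
    \<open>[0, max_info]\<close>.\<close>
  define u where "u h g = row_info g + (if h < lev k then cell_info g - row_info g else 0)" for h g
  have V: "V k v = (\<Sum>i<k. u i (v ! i))" for v
  proof -
    have "(\<Sum>h<lev k. cell_info (v ! h) - row_info (v ! h)) =
        (\<Sum>h<k. if h < lev k then cell_info (v ! h) - row_info (v ! h) else 0)"
      using lev_le[of k] by (intro sum.mono_neutral_cong_left) auto
    then show ?thesis by (simp add: V_def u_def sum.distrib)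
  qed
  have len: "length w = M" using w by (simp add: words_def)
  have "V k (w[h := g]) - V k w = (\<Sum>i<k. u i (w[h := g] ! i) - u i (w ! i))"
    by (simp add: V sum_subtractf)
  also have "\<dots> = (\<Sum>i<k. if i = h then u h g - u h (w ! h) else 0)"
    using len assms(4) by (intro sum.cong) (auto simp: nth_list_update)
  also have "\<dots> = (if h < k then u h g - u h (w ! h) else 0)"
    by (simp add: sum.delta)
  finally have eq: "V k (w[h := g]) - V k w = (if h < k then u h g - u h (w ! h) else 0)" .
  have u: "0 \<le> u h x \<and> u h x \<le> max_info" if "x \<in> G" for x
    using row_info_nonneg[OF that] row_info_le[OF that] cell_info_le[OF that]
    by (auto simp: u_def)
  show ?thesis unfolding eq using u[OF g] u[OF nth_words[OF w assms(3)]] max_info_pos by auto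
qed

text \<open>Resampling the coordinate \<open>h\<close> makes it independent of the event \<open>V k w \<le> T\<close>, and changes
  that event only if \<open>V k w\<close> is within \<^term>\<open>max_info\<close> of \<open>T\<close>.\<close>

lemma decoupling:
  assumes "h < M" "k \<le> M" and D: "\<And>g. g \<in> G \<Longrightarrow> 0 \<le> D g \<and> D g \<le> max_info"
  shows "\<bar>avg M (\<lambda>w. D (w ! h) * of_bool (V k w \<le> T)) -
           (\<Sum>g\<in>G. P g * D g) * avg M (\<lambda>w. of_bool (V k w \<le> T))\<bar>
         \<le> max_info * avg M (\<lambda>w. of_bool (\<bar>V k w - T\<bar> \<le> max_info))"
proof -
  let ?I = "\<lambda>w. of_bool (V k w \<le> T) :: real"
  let ?J = "\<lambda>w. of_bool (\<bar>V k w - T\<bar> \<le> max_info) :: real"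
  have eq: "avg M (\<lambda>w. D (w ! h) * ?I w) = avg M (\<lambda>w. \<Sum>g\<in>G. P g * (D g * ?I (w[h := g])))"
  proof -
    have "avg M (\<lambda>w. D (w ! h) * ?I w) =
        avg M (\<lambda>w. \<Sum>g\<in>G. P g * (D (w[h := g] ! h) * ?I (w[h := g])))"
      using avg_resample[OF assms(1), of "\<lambda>w. D (w ! h) * ?I w"] by simp
    also have "\<dots> = avg M (\<lambda>w. \<Sum>g\<in>G. P g * (D g * ?I (w[h := g])))"
      by (rule avg_cong) (use assms(1) in \<open>simp add: words_def\<close>)
    finally show ?thesis .
  qed
  have close: "\<bar>(\<Sum>g\<in>G. P g * (D g * ?I (w[h := g]))) - (\<Sum>g\<in>G. P g * D g) * ?I w\<bar> \<le> max_info * ?J w"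
    if w: "w \<in> words M" for w
  proof -
    have "\<bar>(\<Sum>g\<in>G. P g * (D g * ?I (w[h := g]))) - (\<Sum>g\<in>G. P g * D g) * ?I w\<bar> =
        \<bar>\<Sum>g\<in>G. P g * (D g * (?I (w[h := g]) - ?I w))\<bar>"
      by (simp add: sum_distrib_right sum_subtractf[symmetric] algebra_simps)
    also have "\<dots> \<le> (\<Sum>g\<in>G. \<bar>P g * (D g * (?I (w[h := g]) - ?I w))\<bar>)"
      by (rule sum_abs)
    also have "\<dots> \<le> (\<Sum>g\<in>G. P g * (max_info * ?J w))"
    proof (intro sum_mono)
      fix g assume g: "g \<in> G"
      have "\<bar>?I (w[h := g]) - ?I w\<bar> \<le> ?J w"
        using V_update[OF w g assms(1,2)] by (auto simp: of_bool_def)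
      then have "D g * \<bar>?I (w[h := g]) - ?I w\<bar> \<le> max_info * ?J w"
        using D[OF g] max_info_pos by (intro mult_mono) auto
      then show "\<bar>P g * (D g * (?I (w[h := g]) - ?I w))\<bar> \<le> P g * (max_info * ?J w)"
        using P_pos[OF g] D[OF g] by (simp add: abs_mult)
    qed
    also have "\<dots> = max_info * ?J w"
      by (simp add: P_sum flip: sum_distrib_right)
    finally show ?thesis .
  qed
  have "avg M (\<lambda>w. \<Sum>g\<in>G. P g * (D g * ?I (w[h := g]))) - (\<Sum>g\<in>G. P g * D g) * avg M ?I
      = avg M (\<lambda>w. (\<Sum>g\<in>G. P g * (D g * ?I (w[h := g]))) - (\<Sum>g\<in>G. P g * D g) * ?I w)" (is "_ = avg M ?d")
    by (simp add: avg_diff avg_cmult)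
  moreover have "\<bar>avg M ?d\<bar> \<le> avg M (\<lambda>w. max_info * ?J w)"
    by (rule abs_avg_le) (rule close)
  ultimately show ?thesis unfolding eq by (simp only: avg_cmult)
qed

section \<open>Wald's identity up to a bounded error\<close>

definition stop_avg :: "nat \<Rightarrow> real \<Rightarrow> real" where
  "stop_avg M T = (\<Sum>k<M. avg M (\<lambda>w. of_bool (V k w \<le> T)))"

definition window_const :: real where
  "window_const = (2 * max_info + gap) / slope + 1"

text \<open>Collects the overshoot of \<open>V\<close> beyond \<open>T\<close>, two decouplings per
  level near the threshold, and the rounding in \<open>lev\<close> weighted by
  \<open>cell_entropy - row_entropy\<close>.\<close>

definition stop_const :: real where
  "stop_const = 2 * max_info + 2 * max_info * window_const + cell_entropy - row_entropy"

lemma entropy_le: "row_entropy \<le> cell_entropy"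
  unfolding row_entropy_def cell_entropy_def
  by (intro sum_mono mult_left_mono row_info_le less_imp_le P_pos)

lemma entropy_rate_pos: "0 < entropy_rate"
proof -
  have "0 < cell_entropy" unfolding cell_entropy_def
    using fin card_G cell_info_pos P_pos by (intro sum_pos) auto
  moreover have "0 \<le> row_entropy" unfolding row_entropy_def
    by (intro sum_nonneg mult_nonneg_nonneg row_info_nonneg less_imp_le[OF P_pos])
  ultimately show ?thesis using theta_pos theta_le
    unfolding entropy_rate_def by (intro add_pos_nonneg mult_pos_pos mult_nonneg_nonneg) auto
qed

text \<open>The mean of \<open>V\<close> at the first light level is evaluated twice: it exceeds
  \<open>T\<close> by at most one increment, and telescoping with decoupling gives
  \<open>entropy_rate\<close> times the expected number of heavy levels, up to bounded
  errors.\<close>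

lemma stop_avg_estimate:
  assumes T: "0 \<le> T" and M: "T < slope * real M - gap"
  shows "\<bar>entropy_rate * stop_avg M T - T\<bar> \<le> stop_const"
proof -
  let ?I = "\<lambda>k w. of_bool (V k w \<le> T) :: real"
  let ?J = "\<lambda>k w. of_bool (\<bar>V k w - T\<bar> \<le> max_info) :: real"
  define inc where "inc k = (of_bool (lev (Suc k) = Suc (lev k)) :: real)" for k
  \<comment> \<open>Every word is light at level \<open>M\<close>, so truncating the count at
    \<open>M\<close> loses no heavy level.\<close>
  have VM: "T < V M w" if "w \<in> words M" for w
    using V_growth[OF that, of 0 M] M by simp
  \<comment> \<open>Facts about the first light level \<open>K\<close> of a word: the increments
    below it sum to \<open>V K w\<close>, which lies between \<open>T\<close> and
    \<open>T + 2 * max_info\<close>, and \<open>inc\<close> sums to \<open>lev K\<close>, which is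
    within 1 of \<open>theta * K\<close>.\<close>
  have total: "T \<le> (\<Sum>k<M. (V (Suc k) w - V k w) * ?I k w) \<and>
      (\<Sum>k<M. (V (Suc k) w - V k w) * ?I k w) \<le> T + 2 * max_info \<and>
      \<bar>(\<Sum>k<M. inc k * ?I k w) - theta * (\<Sum>k<M. ?I k w)\<bar> \<le> 1"
    if w: "w \<in> words M" for w
  proof -
    obtain K where K: "K \<le> M" "\<And>k. k < M \<Longrightarrow> V k w \<le> T \<longleftrightarrow> k < K"
      using light_prefix[OF w] by blast
    have restrict: "(\<Sum>k<M. f k * ?I k w) = (\<Sum>k<K. f k)" for f :: "nat \<Rightarrow> real"
      using K by (intro sum.mono_neutral_cong_right) auto
    have VK: "T < V K w" using K(1) K(2)[of K] VM[OF w] by (cases "K < M") auto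
    then have "K \<noteq> 0" using T by (intro notI) simp
    then obtain K' where K': "K = Suc K'" by (cases K) auto
    have "V K w \<le> T + 2 * max_info"
      using V_increment(2)[OF w, of K'] K(2)[of K'] K(1) K' by auto
    moreover have "(\<Sum>k<M. (V (Suc k) w - V k w) * ?I k w) = V K w"
      unfolding restrict by (simp add: sum_lessThan_telescope[of "\<lambda>k. V k w"])
    moreover have "(\<Sum>k<M. inc k * ?I k w) = real (lev K)"
    proof -
      have "inc k = real (lev (Suc k)) - real (lev k)" for k
        using lev_Suc[of k] by (auto simp: inc_def)
      then show ?thesis unfolding restrict
        by (simp add: sum_lessThan_telescope[of "\<lambda>k. real (lev k)"])
    qed
    moreover have "(\<Sum>k<M. ?I k w) = real K" using restrict[of "\<lambda>_. 1"] by simp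
    ultimately show ?thesis using VK lev_upper[of K] lev_lower[of K] by auto
  qed
  define X where "X = avg M (\<lambda>w. \<Sum>k<M. (V (Suc k) w - V k w) * ?I k w)"
  have X1: "T \<le> X" unfolding X_def using avg_mono[of M "\<lambda>_. T"] total by simp
  have X2: "X \<le> T + 2 * max_info" unfolding X_def
    using avg_mono[of M _ "\<lambda>_. T + 2 * max_info"] total by simp
  define Y where "Y = avg M (\<lambda>w. \<Sum>k<M. inc k * ?I k w)"
  have stop: "stop_avg M T = avg M (\<lambda>w. \<Sum>k<M. ?I k w)"
    by (simp only: stop_avg_def avg_sum)
  have Y: "\<bar>Y - theta * stop_avg M T\<bar> \<le> 1"
  proof -
    have eq: "Y - theta * stop_avg M T =
        avg M (\<lambda>w. (\<Sum>k<M. inc k * ?I k w) - theta * (\<Sum>k<M. ?I k w))"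
      unfolding Y_def stop by (simp only: avg_diff avg_cmult)
    show ?thesis unfolding eq
      using abs_avg_le[of M _ "\<lambda>_. 1"] total by simp
  qed
  \<comment> \<open>Expected number of levels at which resampling one letter can change
    heaviness.\<close>
  define Z where "Z = avg M (\<lambda>w. \<Sum>k<M. ?J k w)"
  have Z: "Z \<le> window_const"
    unfolding Z_def window_const_def
    using avg_mono[of M _ "\<lambda>_. (2 * max_info + gap) / slope + 1"] V_window_count max_info_pos
    by (simp add: less_imp_le)
  let ?a = "\<lambda>k. avg M (\<lambda>w. row_info (w ! k) * ?I k w)"
  let ?b = "\<lambda>k. avg M (\<lambda>w. (cell_info (w ! lev k) - row_info (w ! lev k)) * ?I k w)"
  let ?D = "cell_entropy - row_entropy"
  have "X = (\<Sum>k<M. ?a k + inc k * ?b k)"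
  proof -
    have "(V (Suc k) w - V k w) * ?I k w = row_info (w ! k) * ?I k w +
        inc k * ((cell_info (w ! lev k) - row_info (w ! lev k)) * ?I k w)" for k w
      by (auto simp: V_Suc inc_def)
    then show ?thesis unfolding X_def by (simp only: avg_sum avg_add avg_cmult)
  qed
  \<comment> \<open>The value \<open>X\<close> would have if each revealed letter were independent
    of the heaviness of its level.\<close>
  moreover have "row_entropy * stop_avg M T + ?D * Y =
      (\<Sum>k<M. row_entropy * avg M (?I k) + inc k * (?D * avg M (?I k)))"
  proof -
    have "Y = (\<Sum>k<M. inc k * avg M (?I k))" unfolding Y_def by (simp only: avg_sum avg_cmult)
    then show ?thesis unfolding stop_avg_def
      by (simp only: sum_distrib_left sum.distrib mult.left_commute)
  qed
  ultimately have "\<bar>X - (row_entropy * stop_avg M T + ?D * Y)\<bar> =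
      \<bar>\<Sum>k<M. (?a k - row_entropy * avg M (?I k)) + inc k * (?b k - ?D * avg M (?I k))\<bar>"
    by (simp only: sum_subtractf[symmetric]) (simp add: algebra_simps)
  also have "\<dots> \<le> (\<Sum>k<M. 2 * max_info * avg M (?J k))"
  proof (rule order_trans[OF sum_abs], intro sum_mono)
    fix k assume "k \<in> {..<M}"
    then have k: "k < M" "lev k < M" using lev_le[of k] by auto
    have 1: "\<bar>?a k - row_entropy * avg M (?I k)\<bar> \<le> max_info * avg M (?J k)"
      unfolding row_entropy_def using k
      by (intro decoupling conjI row_info_nonneg order_trans[OF row_info_le cell_info_le]) auto
    have D: "?D = (\<Sum>g\<in>G. P g * (cell_info g - row_info g))"
      by (simp add: cell_entropy_def row_entropy_def sum_subtractf algebra_simps)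
    have 2: "\<bar>?b k - ?D * avg M (?I k)\<bar> \<le> max_info * avg M (?J k)"
    proof (unfold D, rule decoupling)
      fix g assume g: "g \<in> G"
      show "0 \<le> cell_info g - row_info g \<and> cell_info g - row_info g \<le> max_info"
        using row_info_nonneg[OF g] row_info_le[OF g] cell_info_le[OF g] by linarith
    qed (use k in auto)
    have "\<bar>inc k * (?b k - ?D * avg M (?I k))\<bar> \<le> max_info * avg M (?J k)"
      using 2 by (auto simp: inc_def of_bool_def)
    with 1 show "\<bar>(?a k - row_entropy * avg M (?I k)) + inc k * (?b k - ?D * avg M (?I k))\<bar>
        \<le> 2 * max_info * avg M (?J k)" by linarith
  qed
  also have "\<dots> = 2 * max_info * Z"
    unfolding Z_def by (simp only: avg_sum sum_distrib_left)
  also have "\<dots> \<le> 2 * max_info * window_const"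
    using Z max_info_pos by (intro mult_left_mono) auto
  finally have main: "\<bar>X - (row_entropy * stop_avg M T + ?D * Y)\<bar> \<le> 2 * max_info * window_const" .
  \<comment> \<open>\<open>Y\<close> is replaced by \<open>theta * stop_avg M T\<close> at the cost
    of the rounding error of \<open>lev\<close> times \<open>?D\<close>.\<close>
  have "\<bar>?D * (Y - theta * stop_avg M T)\<bar> \<le> ?D * 1"
    unfolding abs_mult using Y entropy_le by (intro mult_mono) auto
  then have "\<bar>?D * Y - ?D * theta * stop_avg M T\<bar> \<le> ?D"
    by (simp add: algebra_simps)
  moreover have "entropy_rate * stop_avg M T = row_entropy * stop_avg M T + ?D * theta * stop_avg M T"
    by (simp add: entropy_rate_def algebra_simps)
  ultimately show ?thesis using main X1 X2 unfolding stop_const_def by linarith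
qed

end

section \<open>Light squares near a finite set\<close>

fun digits_nat :: "nat \<Rightarrow> nat list \<Rightarrow> nat" where
  "digits_nat b [] = 0"
| "digits_nat b (d # ds) = d * b ^ length ds + digits_nat b ds"

text \<open>The finite expansion \<open>0.d1d2...\<close> in base \<open>b\<close>, that is, the
  left end of a \<open>b\<close>-adic interval.\<close>

definition digits_frac :: "nat \<Rightarrow> nat list \<Rightarrow> real" where
  "digits_frac b ds = real (digits_nat b ds) / real b ^ length ds"

lemma digits_nat_less: "set ds \<subseteq> {..<b} \<Longrightarrow> digits_nat b ds < b ^ length ds"
proof (induction ds)
  case (Cons d ds)
  then have "digits_nat b (d # ds) < Suc d * b ^ length ds" by simp
  also have "\<dots> \<le> b * b ^ length ds" using Cons.prems by (intro mult_right_mono) auto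
  finally show ?case by simp
qed simp

lemma digits_nat_inj:
  assumes "length ds = length es" "set ds \<subseteq> {..<b}" "set es \<subseteq> {..<b}"
    "digits_nat b ds = digits_nat b es"
  shows "ds = es"
  using assms
proof (induction ds es rule: list_induct2)
  case (Cons d ds e es)
  have eq: "d * b ^ length ds + digits_nat b ds = e * b ^ length ds + digits_nat b es"
    using Cons by simp
  have less: "digits_nat b ds < b ^ length ds" "digits_nat b es < b ^ length ds"
    using digits_nat_less[of ds b] digits_nat_less[of es b] Cons by auto
  have "d = (d * b ^ length ds + digits_nat b ds) div b ^ length ds"
    using less(1) by (intro div_nat_eqI [symmetric]) (auto simp: mult_ac)
  also have "\<dots> = e" unfolding eq
    using less(2) Cons.hyps by (intro div_nat_eqI) (auto simp: mult_ac)
  finally show ?case using eq Cons by simp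
qed simp

lemma digits_frac_Nil [simp]: "digits_frac b [] = 0"
  by (simp add: digits_frac_def)

lemma digits_frac_Cons:
  "0 < b \<Longrightarrow> digits_frac b (d # ds) = (real d + digits_frac b ds) / real b"
  by (simp add: digits_frac_def field_simps)

lemma digits_frac_append:
  "0 < b \<Longrightarrow> digits_frac b (ds @ es) = digits_frac b ds + digits_frac b es / real b ^ length ds"
  by (induction ds) (simp_all add: digits_frac_Cons field_simps)

lemma digits_frac_nonneg: "0 \<le> digits_frac b ds"
  by (simp add: digits_frac_def)

lemma digits_frac_le_1:
  assumes "set ds \<subseteq> {..<b}"
  shows "digits_frac b ds \<le> 1"
proof -
  have "real (digits_nat b ds) \<le> real (b ^ length ds)"
    using digits_nat_less[OF assms] by (intro of_nat_mono) simp
  then show ?thesis by (cases "b = 0") (auto simp: digits_frac_def divide_le_eq_1)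
qed

lemma digits_frac_close:
  assumes "length ds = length es" "0 < b"
    "\<bar>digits_frac b ds - digits_frac b es\<bar> \<le> real r / real b ^ length es"
  shows "int (digits_nat b ds) \<in> {int (digits_nat b es) - int r..int (digits_nat b es) + int r}"
proof -
  have "\<bar>real (digits_nat b ds) - real (digits_nat b es)\<bar> / real b ^ length es \<le> real r / real b ^ length es"
    using assms by (simp add: digits_frac_def diff_divide_distrib[symmetric] abs_divide)
  then have "\<bar>real (digits_nat b ds) - real (digits_nat b es)\<bar> \<le> real r"
    using assms(2) by (simp add: divide_le_cancel zero_less_power)
  then show ?thesis by (simp add: abs_le_iff)
qed

text \<open>Dropping a digit moves the point by at most one coarse unit, and four fine units are at
  most two coarse ones.\<close>

lemma digits_frac_parent_close:
  assumes b: "2 \<le> b" and d: "d < b"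
    and close: "\<bar>digits_frac b (ds @ [d]) - x\<bar> \<le> 4 / real b ^ Suc (length ds)"
  shows "\<bar>digits_frac b ds - x\<bar> \<le> 4 / real b ^ length ds"
proof -
  define y where "y = 1 / real b ^ length ds"
  have y: "0 \<le> y" unfolding y_def by simp
  have z: "4 / real b ^ Suc (length ds) \<le> 2 * y"
    using b by (simp add: y_def field_simps)
  have eq: "digits_frac b (ds @ [d]) = digits_frac b ds + (real d / real b) * y"
    using b by (subst digits_frac_append) (auto simp: y_def digits_frac_Cons)
  have "(real d / real b) * y \<le> 1 * y"
    using d by (intro mult_right_mono y) (simp add: divide_le_eq)
  moreover have "0 \<le> (real d / real b) * y" using y by simp
  ultimately have "\<bar>digits_frac b ds - x\<bar> \<le> 4 * y"
    using close eq z y by linarith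
  then show ?thesis by (simp add: y_def)
qed

context carpet
begin

section \<open>Codes of approximate squares and their masses\<close>

definition code :: "nat \<Rightarrow> (nat \<times> nat) list \<Rightarrow> nat list \<times> nat list" where
  "code k w = (map fst (take (lev k) w), map snd (take k w))"

lemma V_code_cong:
  assumes "w \<in> words M" "w' \<in> words M" "k \<le> M" "code k w = code k w'"
  shows "V k w = V k w'"
proof -
  have len: "length w = M" "length w' = M" using assms by (auto simp: words_def)
  have s: "snd (w ! h) = snd (w' ! h)" if "h < k" for h
  proof -
    have "map snd (take k w) ! h = map snd (take k w') ! h"
      using assms(4) by (simp add: code_def)
    then show ?thesis using that len assms(3) by simp
  qed
  have f: "w ! h = w' ! h" if "h < lev k" for h
  proof -
    have "map fst (take (lev k) w) ! h = map fst (take (lev k) w') ! h"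
      using assms(4) by (simp add: code_def)
    then have "fst (w ! h) = fst (w' ! h)" using that len assms(3) lev_le[of k] by simp
    then show ?thesis using s[of h] that lev_le[of k] by (simp add: prod_eq_iff)
  qed
  show ?thesis unfolding V_def using s f
    by (intro arg_cong2[where f = "(+)"] sum.cong) (auto simp: row_info_def)
qed

text \<open>By independence each fully prescribed letter contributes the factor \<open>P\<close> and
  each letter with prescribed row the factor \<open>row_mass\<close>. The number \<open>l\<close> is
  kept free because removing the first letter does not preserve \<open>l = lev k\<close>.\<close>

lemma avg_prefix:
  assumes "w0 \<in> words M" "l \<le> k" "k \<le> M"
  shows "avg M (\<lambda>w. of_bool (map fst (take l w) = map fst (take l w0) \<and>
            map snd (take k w) = map snd (take k w0))) =
         exp (- (\<Sum>h<k. row_info (w0 ! h)) - (\<Sum>h<l. cell_info (w0 ! h) - row_info (w0 ! h)))"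
  using assms
proof (induction M arbitrary: w0 l k)
  case 0
  then show ?case by simp
next
  case (Suc M)
  show ?case
  proof (cases k)
    case 0
    then show ?thesis using Suc.prems(2) by (simp del: avg.simps)
  next
    case (Suc k')
    from Suc.prems(1) obtain g0 v0 where w0: "w0 = g0 # v0" "g0 \<in> G" "v0 \<in> words M"
      unfolding words_Suc_iff by blast
    have e: "exp (- row_info g0) = row_mass (snd g0)" "exp (- cell_info g0) = P g0"
      using row_mass_pos[OF w0(2)] P_pos[OF w0(2)] by (auto simp: row_info_def cell_info_def)
    show ?thesis
    proof (cases l)
      case 0
      define A where "A = avg M (\<lambda>w. of_bool (map snd (take k' w) = map snd (take k' v0)))"
      have A: "A = exp (- (\<Sum>h<k'. row_info (v0 ! h)))"
        using Suc.IH[OF w0(3), of 0 k'] Suc.prems(3) \<open>k = Suc k'\<close> by (simp add: A_def)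
      have "avg (Suc M) (\<lambda>w. of_bool (map fst (take l w) = map fst (take l w0) \<and>
            map snd (take k w) = map snd (take k w0))) =
          (\<Sum>g\<in>G. P g * avg M (\<lambda>w. of_bool (snd g = snd g0) * of_bool (map snd (take k' w) = map snd (take k' v0))))"
        using 0 Suc w0 by (simp add: of_bool_conj)
      also have "\<dots> = (\<Sum>g\<in>G. P g * of_bool (snd g = snd g0)) * A"
        by (simp only: avg_cmult A_def sum_distrib_right mult.assoc)
      also have "(\<Sum>g\<in>G. P g * of_bool (snd g = snd g0)) = row_mass (snd g0)"
        unfolding row_mass_def using fin by (intro sum.mono_neutral_cong_right) auto
      finally show ?thesis
        using 0 Suc w0(1) by (simp add: A sum.lessThan_Suc_shift e(1)[symmetric] del: sum.lessThan_Suc flip: exp_add)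
    next
      \<comment> \<open>The first letter is prescribed entirely: its column through
        \<open>l\<close>, its row through \<open>k\<close>.\<close>
      case (Suc l')
      define A where "A = avg M (\<lambda>w. of_bool (map fst (take l' w) = map fst (take l' v0) \<and>
            map snd (take k' w) = map snd (take k' v0)))"
      have A: "A = exp (- (\<Sum>h<k'. row_info (v0 ! h)) - (\<Sum>h<l'. cell_info (v0 ! h) - row_info (v0 ! h)))"
        using Suc.IH[OF w0(3), of l' k'] Suc.prems(2,3) \<open>k = Suc k'\<close> Suc unfolding A_def by simp
      have "avg (Suc M) (\<lambda>w. of_bool (map fst (take l w) = map fst (take l w0) \<and>
            map snd (take k w) = map snd (take k w0))) =
          (\<Sum>g\<in>G. P g * avg M (\<lambda>w. of_bool (g = g0) * of_bool (map fst (take l' w) = map fst (take l' v0) \<and>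
            map snd (take k' w) = map snd (take k' v0))))"
        unfolding avg.simps using \<open>k = Suc k'\<close> Suc w0
        by (intro sum.cong refl arg_cong2[where f = "(*)"] avg_cong)
          (auto simp: prod_eq_iff)
      also have "\<dots> = (\<Sum>g\<in>G. P g * of_bool (g = g0)) * A"
        by (simp only: avg_cmult A_def sum_distrib_right mult.assoc)
      also have "(\<Sum>g\<in>G. P g * of_bool (g = g0)) = P g0"
      proof -
        have "(\<Sum>g\<in>G. P g * of_bool (g = g0)) = (\<Sum>g\<in>G. if g = g0 then P g else 0)"
          by (intro sum.cong) auto
        then show ?thesis using fin w0(2) by simp
      qed
      finally show ?thesis
        using \<open>k = Suc k'\<close> Suc w0(1)
        by (simp add: A sum.lessThan_Suc_shift e(2)[symmetric] del: sum.lessThan_Suc flip: exp_add)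
    qed
  qed
qed

lemma avg_code:
  assumes "w0 \<in> words M" "k \<le> M"
  shows "avg M (\<lambda>w. of_bool (code k w = code k w0)) = exp (- V k w0)"
  using avg_prefix[OF assms(1) lev_le assms(2)] by (simp add: code_def V_def)

definition heavy :: "nat \<Rightarrow> real \<Rightarrow> nat \<Rightarrow> (nat list \<times> nat list) set" where
  "heavy M T k = code k ` {w \<in> words M. V k w \<le> T}"

lemma finite_heavy: "finite (heavy M T k)"
  by (simp add: heavy_def finite_words)

lemma heavy_iff:
  assumes "w \<in> words M" "k \<le> M"
  shows "code k w \<in> heavy M T k \<longleftrightarrow> V k w \<le> T"
proof
  assume "code k w \<in> heavy M T k"
  then obtain w' where "w' \<in> words M" "V k w' \<le> T" "code k w = code k w'"
    unfolding heavy_def by blast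
  then show "V k w \<le> T" using V_code_cong[OF assms(1) _ assms(2)] by metis
qed (use assms in \<open>auto simp: heavy_def\<close>)

text \<open>A code of mass \<open>exp (- V)\<close> contributes exactly 1 to the mean of
  \<open>exp V\<close>, so the number of heavy codes is such a mean, which
  \<open>sum_exp_V_le\<close> bounds word by word.\<close>

lemma sum_card_heavy: "(\<Sum>k<M. real (card (heavy M T k))) \<le> heavy_const * exp T"
proof -
  have "real (card (heavy M T k)) = avg M (\<lambda>w. of_bool (V k w \<le> T) * exp (V k w))"
    if k: "k < M" for k
  proof -
    have one: "avg M (\<lambda>w. of_bool (code k w = c) * exp (V k w)) = 1" if c: "c \<in> heavy M T k" for c
    proof -
      obtain w0 where w0: "w0 \<in> words M" "c = code k w0" using c by (auto simp: heavy_def)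
      have "avg M (\<lambda>w. of_bool (code k w = c) * exp (V k w)) =
          avg M (\<lambda>w. exp (V k w0) * of_bool (code k w = code k w0))"
        unfolding w0(2)
        by (rule avg_cong) (use V_code_cong[OF _ w0(1)] k in \<open>auto simp: of_bool_def\<close>)
      also have "\<dots> = 1"
        using avg_code[OF w0(1), of k] k by (simp add: avg_cmult flip: exp_add)
      finally show ?thesis .
    qed
    have "avg M (\<lambda>w. of_bool (V k w \<le> T) * exp (V k w)) =
        avg M (\<lambda>w. \<Sum>c\<in>heavy M T k. of_bool (code k w = c) * exp (V k w))"
    proof (rule avg_cong)
      fix w assume w: "w \<in> words M"
      have "(\<Sum>c\<in>heavy M T k. of_bool (code k w = c) * exp (V k w)) =
          of_bool (code k w \<in> heavy M T k) * exp (V k w)"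
        using finite_heavy by (simp add: of_bool_def flip: sum_distrib_right)
      then show "of_bool (V k w \<le> T) * exp (V k w) =
          (\<Sum>c\<in>heavy M T k. of_bool (code k w = c) * exp (V k w))"
        using heavy_iff[OF w, of k T] k by simp
    qed
    also have "\<dots> = (\<Sum>c\<in>heavy M T k. 1)"
      unfolding avg_sum by (rule sum.cong) (use one in auto)
    finally show ?thesis by simp
  qed
  then have "(\<Sum>k<M. real (card (heavy M T k))) =
      avg M (\<lambda>w. \<Sum>k<M. of_bool (V k w \<le> T) * exp (V k w))"
    by (simp only: avg_sum) (auto intro: sum.cong)
  also have "\<dots> \<le> heavy_const * exp T"
    using avg_mono[of M _ "\<lambda>_. heavy_const * exp T"] sum_exp_V_le by simp
  finally show ?thesis .
qed

text \<open>The constant 4 is large enough for nearness to pass to the parent square, as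
  \<open>4 / b + 1 \<le> 4\<close> for \<open>b \<ge> 2\<close>.\<close>

definition near :: "nat \<Rightarrow> nat list \<times> nat list \<Rightarrow> real \<times> real \<Rightarrow> bool" where
  "near k c a \<longleftrightarrow> \<bar>digits_frac n (fst c) - fst a\<bar> \<le> 4 / real n ^ lev k \<and>
     \<bar>digits_frac m (snd c) - snd a\<bar> \<le> 4 / real m ^ k"

lemma word_digits:
  assumes "w \<in> words M"
  shows "set (map fst w) \<subseteq> {..<n}" "set (map snd w) \<subseteq> {..<m}"
  using assms G_digits by (fastforce simp: words_def)+

lemma code_digits:
  assumes "w \<in> words M" "k \<le> M"
  shows "set (fst (code k w)) \<subseteq> {..<n}" "set (snd (code k w)) \<subseteq> {..<m}"
    "length (fst (code k w)) = lev k" "length (snd (code k w)) = k"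
proof -
  have "set (take i w) \<subseteq> {..<n} \<times> {..<m}" for i
    using assms(1) G_digits set_take_subset[of i w] by (auto simp: words_def)
  then show "set (fst (code k w)) \<subseteq> {..<n}" "set (snd (code k w)) \<subseteq> {..<m}"
    by (fastforce simp: code_def)+
  show "length (fst (code k w)) = lev k" "length (snd (code k w)) = k"
    using assms lev_le[of k] by (auto simp: code_def words_def)
qed

section \<open>Counting squares near a point and bounding the light ones\<close>

lemma finite_codes: "finite (code k ` words M)"
  by (simp add: finite_words)

text \<open>A common near point puts the integer digit values of the two codes within 4 + 4 = 8
  units in each coordinate. These values determine a code, and 289 = 17 * 17.\<close>

lemma card_near_both:
  assumes "k \<le> M" "c' \<in> code k ` words M"
  shows "card {c \<in> code k ` words M. \<exists>a. near k c a \<and> near k c' a} \<le> 289"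
proof -
  let ?S = "{c \<in> code k ` words M. \<exists>a. near k c a \<and> near k c' a}"
  define f where "f c = (int (digits_nat n (fst c)), int (digits_nat m (snd c)))" for c :: "nat list \<times> nat list"
  let ?I = "\<lambda>z. {z - int 8..z + int 8}"
  have pos: "0 < n" "0 < m" using m_ge n_ge by auto
  have "inj_on f ?S"
  proof (rule inj_onI)
    fix c d assume cd: "c \<in> ?S" "d \<in> ?S" "f c = f d"
    then obtain w v where "w \<in> words M" "v \<in> words M" "c = code k w" "d = code k v" by auto
    then show "c = d"
      using cd(3) code_digits[of w M k] code_digits[of v M k] assms(1)
        digits_nat_inj[of "fst c" "fst d" n] digits_nat_inj[of "snd c" "snd d" m]
      by (simp add: f_def prod_eq_iff)
  qed
  moreover have "f ` ?S \<subseteq> ?I (fst (f c')) \<times> ?I (snd (f c'))"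
  proof
    fix z assume "z \<in> f ` ?S"
    then obtain c where "z = f c" "c \<in> ?S" by (rule imageE)
    then obtain a where c: "c \<in> code k ` words M" "near k c a" "near k c' a" "z = f c" by blast
    have len: "length (fst c) = length (fst c')" "length (snd c) = length (snd c')"
      "length (fst c') = lev k" "length (snd c') = k"
      using c(1) assms code_digits(3,4) by auto
    have "\<bar>digits_frac n (fst c) - digits_frac n (fst c')\<bar> \<le> real 8 / real n ^ length (fst c')"
      "\<bar>digits_frac m (snd c) - digits_frac m (snd c')\<bar> \<le> real 8 / real m ^ length (snd c')"
      using c(2,3) len(3,4) unfolding near_def by (auto simp: abs_le_iff field_simps)
    then show "z \<in> ?I (fst (f c')) \<times> ?I (snd (f c'))"
      using digits_frac_close[OF len(1) pos(1), of 8] digits_frac_close[OF len(2) pos(2), of 8]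
      unfolding c(4) f_def mem_Times_iff fst_conv snd_conv by blast
  qed
  ultimately have "card ?S \<le> card (?I (fst (f c')) \<times> ?I (snd (f c')))"
    by (intro card_inj_on_le) auto
  then show ?thesis by (simp add: card_cartesian_product)
qed

lemma near_parent:
  assumes w: "w \<in> words M" and "Suc k \<le> M" and near: "near (Suc k) (code (Suc k) w) a"
  shows "near k (code k w) a"
proof -
  have len: "length w = M" using w by (simp add: words_def)
  have G: "fst (w ! h) < n" "snd (w ! h) < m" if "h < M" for h
    using nth_words[OF w that] G_digits by auto
  have k: "k < M" "lev k < M" using assms(2) lev_le[of k] by auto
  have "\<bar>digits_frac m (map snd (take k w)) - snd a\<bar> \<le> 4 / real m ^ length (map snd (take k w))"
    using near k len m_ge G(2)[of k]
    by (intro digits_frac_parent_close[where d = "snd (w ! k)"])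
      (auto simp: near_def code_def take_Suc_conv_app_nth)
  moreover have "\<bar>digits_frac n (map fst (take (lev k) w)) - fst a\<bar> \<le> 4 / real n ^ lev k"
    using lev_Suc[of k]
  proof
    assume "lev (Suc k) = lev k"
    then show ?thesis using near by (simp add: near_def code_def)
  next
    assume l: "lev (Suc k) = Suc (lev k)"
    have "\<bar>digits_frac n (map fst (take (lev k) w)) - fst a\<bar> \<le> 4 / real n ^ length (map fst (take (lev k) w))"
      using near k len m_ge n_ge G(1)[of "lev k"] l
      by (intro digits_frac_parent_close[where d = "fst (w ! lev k)"])
        (auto simp: near_def code_def take_Suc_conv_app_nth)
    then show ?thesis using k len by simp
  qed
  ultimately show ?thesis using k len by (simp add: near_def code_def)
qed

lemma near_ancestor:
  assumes "w \<in> words M" "j \<le> k" "k \<le> M" "near k (code k w) a"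
  shows "near j (code j w) a"
  using assms(2-4)
proof (induction k rule: dec_induct)
  case (step i)
  then show ?case using near_parent[OF assms(1), of i a] by simp
qed simp

text \<open>Each light square is charged to a heavy square near the same point. A heavy square
  receives at most 289 charges of mass at most \<open>exp (- T)\<close>, and there are at most
  \<open>heavy_const * exp T\<close> heavy squares in all.\<close>

lemma light_near_heavy_sum:
  "(\<Sum>k<M. avg M (\<lambda>w. of_bool (code k w \<in> {c \<in> code k ` words M - heavy M T k.
      \<exists>a. near k c a \<and> (\<exists>c'\<in>heavy M T k. near k c' a)}))) \<le> 289 * heavy_const"
proof -
  define S where "S k = {c \<in> code k ` words M - heavy M T k.
      \<exists>a. near k c a \<and> (\<exists>c'\<in>heavy M T k. near k c' a)}" for k
  have "avg M (\<lambda>w. of_bool (code k w \<in> S k)) \<le> 289 * exp (- T) * real (card (heavy M T k))"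
    if k: "k < M" for k
  proof -
    have fS: "finite (S k)" unfolding S_def by (rule finite_subset[OF _ finite_codes[of k M]]) auto
    have "avg M (\<lambda>w. of_bool (code k w = c)) \<le> exp (- T)" if c: "c \<in> S k" for c
    proof -
      obtain w where w: "w \<in> words M" "c = code k w" using c by (auto simp: S_def)
      then have "T < V k w" using c heavy_iff[OF w(1), of k T] k by (auto simp: S_def)
      then show ?thesis using avg_code[OF w(1), of k] k w(2) by simp
    qed
    then have "avg M (\<lambda>w. of_bool (code k w \<in> S k)) \<le> real (card (S k)) * exp (- T)"
      by (intro avg_indicator_le_card fS)
    also have "card (S k) \<le> 289 * card (heavy M T k)"
    proof -
      have "S k \<subseteq> (\<Union>c'\<in>heavy M T k. {c \<in> code k ` words M. \<exists>a. near k c a \<and> near k c' a})"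
        unfolding S_def by blast
      then have "card (S k) \<le> card (\<Union>c'\<in>heavy M T k. {c \<in> code k ` words M. \<exists>a. near k c a \<and> near k c' a})"
        using finite_heavy finite_codes by (intro card_mono finite_UN_I) auto
      also have "\<dots> \<le> (\<Sum>c'\<in>heavy M T k. card {c \<in> code k ` words M. \<exists>a. near k c a \<and> near k c' a})"
        by (intro card_UN_le finite_heavy)
      also have "\<dots> \<le> (\<Sum>c'\<in>heavy M T k. 289)"
        using k by (intro sum_mono card_near_both) (auto simp: heavy_def)
      finally show ?thesis by simp
    qed
    then have "real (card (S k)) * exp (- T) \<le> real (289 * card (heavy M T k)) * exp (- T)"
      by (intro mult_right_mono of_nat_mono) auto
    finally show ?thesis by (simp add: mult_ac)
  qed
  then have "(\<Sum>k<M. avg M (\<lambda>w. of_bool (code k w \<in> S k))) \<le>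
      (\<Sum>k<M. 289 * exp (- T) * real (card (heavy M T k)))"
    by (intro sum_mono) auto
  also have "\<dots> = 289 * exp (- T) * (\<Sum>k<M. real (card (heavy M T k)))"
    by (simp add: sum_distrib_left)
  also have "\<dots> \<le> 289 * exp (- T) * (heavy_const * exp T)"
    by (intro mult_left_mono sum_card_heavy) auto
  also have "\<dots> = 289 * heavy_const" by (simp add: exp_minus)
  finally show ?thesis by (simp add: S_def)
qed

text \<open>From the first level on which all squares near \<open>a\<close> are light, so are all deeper ones,
  and their masses decay geometrically.\<close>

lemma all_near_light_sum:
  "(\<Sum>k<M. avg M (\<lambda>w. of_bool (code k w \<in> {c \<in> code k ` words M.
      near k c a \<and> (\<forall>c'\<in>heavy M T k. \<not> near k c' a)}))) \<le> 289 * heavy_const * exp (- T)"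
proof -
  define S where "S k = {c \<in> code k ` words M. near k c a \<and> (\<forall>c'\<in>heavy M T k. \<not> near k c' a)}" for k
  define A where "A k = avg M (\<lambda>w. of_bool (code k w \<in> S k))" for k
  have "(\<Sum>k<M. A k) \<le> 289 * heavy_const * exp (- T)"
  proof (cases "\<exists>k<M. \<forall>c'\<in>heavy M T k. \<not> near k c' a")
    case False
    then have "S k = {}" if "k < M" for k using that by (auto simp: S_def)
    then have "A k = 0" if "k < M" for k using that by (simp add: A_def)
    then show ?thesis using heavy_const_ge_1 by simp
  next
    case True
    \<comment> \<open>The first level without heavy squares near \<open>a\<close>; at earlier levels
      \<open>S k\<close> is empty.\<close>
    define i where "i = (LEAST k. k < M \<and> (\<forall>c'\<in>heavy M T k. \<not> near k c' a))"
    have i: "i < M" "\<And>c'. c' \<in> heavy M T i \<Longrightarrow> \<not> near i c' a"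
      using LeastI_ex[OF True] unfolding i_def by auto
    have "S k = {}" if "k < i" for k
      using not_less_Least[OF that[unfolded i_def]] that i(1) by (auto simp: S_def)
    then have before: "A k = 0" if "k < i" for k
      using that by (simp add: A_def)
    \<comment> \<open>The ancestor at level \<open>i\<close> of a square near \<open>a\<close> is
      itself near \<open>a\<close>, hence light. From there the mass loses a factor
      \<open>exp (- slope)\<close> per level, up to the factor \<open>exp gap\<close>.\<close>
    have after: "A k \<le> 289 * (exp (gap - T) * exp (- slope) ^ (k - i))" if k: "i \<le> k" "k < M" for k
    proof -
      have fS: "finite (S k)" unfolding S_def by (rule finite_subset[OF _ finite_codes[of k M]]) auto
      have "avg M (\<lambda>w. of_bool (code k w = c)) \<le> exp (gap - T) * exp (- slope) ^ (k - i)" if c: "c \<in> S k" for c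
      proof -
        obtain w where w: "w \<in> words M" "c = code k w" using c by (auto simp: S_def)
        have "near i (code i w) a" using near_ancestor[OF w(1) k(1), of a] c k w(2) by (simp add: S_def)
        then have "T < V i w" using i(2)[of "code i w"] heavy_iff[OF w(1), of i T] i(1) by auto
        then have "- V k w \<le> (gap - T) + real (k - i) * (- slope)"
          using V_growth[OF w(1) k(1)] k(2) by (simp add: algebra_simps)
        then have "exp (- V k w) \<le> exp ((gap - T) + real (k - i) * (- slope))" by simp
        also have "\<dots> = exp (gap - T) * exp (- slope) ^ (k - i)"
          by (simp only: exp_add exp_of_nat_mult)
        finally show ?thesis using avg_code[OF w(1), of k] k w(2) by simp
      qed
      then have "A k \<le> real (card (S k)) * (exp (gap - T) * exp (- slope) ^ (k - i))"
        unfolding A_def by (intro avg_indicator_le_card fS)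
      moreover have "card (S k) \<le> 289"
      proof (cases "S k = {}")
        case False
        then obtain c' where c': "c' \<in> S k" by blast
        have "card (S k) \<le> card {c \<in> code k ` words M. \<exists>a. near k c a \<and> near k c' a}"
        proof (rule card_mono)
          show "S k \<subseteq> {c \<in> code k ` words M. \<exists>a. near k c a \<and> near k c' a}"
            using c' unfolding S_def by blast
        qed (use finite_codes[of k M] in simp)
        also have "\<dots> \<le> 289" using c' k by (intro card_near_both) (simp_all add: S_def)
        finally show ?thesis .
      qed simp
      then have "real (card (S k)) * (exp (gap - T) * exp (- slope) ^ (k - i)) \<le>
          289 * (exp (gap - T) * exp (- slope) ^ (k - i))"
        by (intro mult_right_mono) auto
      ultimately show ?thesis by linarith
    qed
    have "(\<Sum>k<M. A k) = (\<Sum>k\<in>{i..<M}. A k)"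
      using before by (intro sum.mono_neutral_right) auto
    also have "\<dots> \<le> (\<Sum>k\<in>{i..<M}. 289 * (exp (gap - T) * exp (- slope) ^ (k - i)))"
      using after by (intro sum_mono) auto
    also have "\<dots> = 289 * exp (gap - T) * (\<Sum>k<M - i. exp (- slope) ^ k)"
      using i(1) by (subst sum.atLeastLessThan_shift_0)
        (simp add: sum_distrib_left mult.assoc lessThan_atLeast0)
    also have "\<dots> \<le> 289 * exp (gap - T) * (1 / (1 - exp (- slope)))"
      using slope_pos by (intro mult_left_mono geometric_sum_le) auto
    also have "\<dots> = 289 * heavy_const * exp (- T)"
      by (simp add: heavy_const_def exp_diff exp_minus field_simps)
    finally show ?thesis .
  qed
  then show ?thesis by (simp add: A_def S_def)
qed

text \<open>A square near \<open>\<alpha>\<close> is heavy, or shares a near point with a heavy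
  square, or is near a point of \<open>\<alpha>\<close> that has no heavy square near it. The last
  class costs a multiple of \<open>exp (- T)\<close> per point, which the bound on
  \<open>card \<alpha>\<close> absorbs; 578 = 2 * 289.\<close>

lemma near_sum_le:
  assumes "finite \<alpha>" "real (card \<alpha>) \<le> exp T"
  shows "(\<Sum>k<M. avg M (\<lambda>w. of_bool (\<exists>a\<in>\<alpha>. near k (code k w) a))) \<le> stop_avg M T + 578 * heavy_const"
proof -
  define S1 where "S1 k = {c \<in> code k ` words M - heavy M T k.
      \<exists>a. near k c a \<and> (\<exists>c'\<in>heavy M T k. near k c' a)}" for k
  define S2 where "S2 a k = {c \<in> code k ` words M. near k c a \<and> (\<forall>c'\<in>heavy M T k. \<not> near k c' a)}" for a k
  have "(\<Sum>k<M. avg M (\<lambda>w. of_bool (\<exists>a\<in>\<alpha>. near k (code k w) a))) \<le>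
      (\<Sum>k<M. avg M (\<lambda>w. of_bool (V k w \<le> T) + of_bool (code k w \<in> S1 k) +
        (\<Sum>a\<in>\<alpha>. of_bool (code k w \<in> S2 a k))))"
  proof (intro sum_mono avg_mono)
    fix k w assume k: "k \<in> {..<M}" and w: "w \<in> words M"
    show "of_bool (\<exists>a\<in>\<alpha>. near k (code k w) a) \<le> of_bool (V k w \<le> T) + of_bool (code k w \<in> S1 k) +
        (\<Sum>a\<in>\<alpha>. of_bool (code k w \<in> S2 a k) :: real)"
    proof (cases "(\<exists>a\<in>\<alpha>. near k (code k w) a) \<and> \<not> V k w \<le> T \<and> code k w \<notin> S1 k")
      case False
      have "0 \<le> (\<Sum>a\<in>\<alpha>. of_bool (code k w \<in> S2 a k) :: real)" by (intro sum_nonneg) simp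
      with False show ?thesis by auto
    next
      case True
      then obtain a where a: "a \<in> \<alpha>" "near k (code k w) a" by blast
      have "code k w \<notin> heavy M T k" using heavy_iff[OF w, of k T] True k by simp
      then have "code k w \<in> S2 a k" using True a w unfolding S1_def S2_def by blast
      then have "1 \<le> (\<Sum>a\<in>\<alpha>. of_bool (code k w \<in> S2 a k) :: real)"
        using member_le_sum[OF a(1), of "\<lambda>a. of_bool (code k w \<in> S2 a k) :: real"] assms(1) by simp
      then show ?thesis by simp
    qed
  qed
  also have "\<dots> = stop_avg M T + (\<Sum>k<M. avg M (\<lambda>w. of_bool (code k w \<in> S1 k))) +
      (\<Sum>a\<in>\<alpha>. \<Sum>k<M. avg M (\<lambda>w. of_bool (code k w \<in> S2 a k)))"
    by (simp only: avg_add avg_sum sum.distrib stop_avg_def) (simp only: sum.swap[of _ \<alpha>])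
  also have "\<dots> \<le> stop_avg M T + 289 * heavy_const + (\<Sum>a\<in>\<alpha>. 289 * heavy_const * exp (- T))"
    unfolding S1_def S2_def
    by (intro add_mono order_refl sum_mono light_near_heavy_sum all_near_light_sum)
  also have "(\<Sum>a\<in>\<alpha>. 289 * heavy_const * exp (- T)) = 289 * heavy_const * (real (card \<alpha>) * exp (- T))"
    by simp
  also have "\<dots> \<le> 289 * heavy_const * 1"
  proof (intro mult_left_mono)
    have "real (card \<alpha>) * exp (- T) \<le> exp T * exp (- T)"
      by (intro mult_right_mono assms) auto
    then show "real (card \<alpha>) * exp (- T) \<le> 1" by (simp add: exp_minus)
  qed (use heavy_const_ge_1 in auto)
  finally show ?thesis by simp
qed

end

section \<open>The self-affine measure\<close>

locale carpet_measure = carpet +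
  fixes \<mu> :: "(real \<times> real) measure"
  assumes prob_mu: "prob_space \<mu>" and sets_mu: "sets \<mu> = sets borel"
    and self_affine: "A \<in> sets borel \<Longrightarrow>
      measure \<mu> A = (\<Sum>g\<in>G. P g * measure (distr \<mu> borel (digit_map n m (fst g) (snd g))) A)"
begin

sublocale prob_space \<mu> by (rule prob_mu)

lemma space_mu [simp]: "space \<mu> = UNIV"
  using sets_eq_imp_space_eq[OF sets_mu] by simp

lemma pos: "0 < n" "0 < m" "0 < real n" "0 < real m"
  using m_ge n_ge by auto

lemma digit_map_eq:
  "digit_map n m i j = (\<lambda>z. ((fst z + real i) / real n, (snd z + real j) / real m))"
  by (auto simp: digit_map_def)

lemma digit_map_measurable: "digit_map n m i j \<in> borel_measurable borel"
  unfolding digit_map_eq using pos by (intro borel_measurable_continuous_onI continuous_intros) auto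

section \<open>Iterated digit maps\<close>

primrec word_map :: "(nat \<times> nat) list \<Rightarrow> real \<times> real \<Rightarrow> real \<times> real" where
  "word_map [] z = z"
| "word_map (g # w) z = digit_map n m (fst g) (snd g) (word_map w z)"

lemma word_map_measurable: "word_map w \<in> borel_measurable borel"
proof (induction w)
  case Nil
  then show ?case by (simp add: word_map_def)
next
  case (Cons g w)
  have "word_map (g # w) = digit_map n m (fst g) (snd g) \<circ> word_map w" by auto
  then show ?case using measurable_comp[OF Cons digit_map_measurable] by (simp only:)
qed

lemma word_map_vimage: "A \<in> sets borel \<Longrightarrow> word_map w -` A \<in> sets borel"
  using measurable_sets[OF word_map_measurable[of w], of A] by simp

lemma word_map_coords:
  "fst (word_map w z) = digits_frac n (map fst w) + fst z / real n ^ length w"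
  "snd (word_map w z) = digits_frac m (map snd w) + snd z / real m ^ length w"
  using pos by (induction w) (simp_all add: digit_map_eq digits_frac_Cons field_simps)

lemma measure_digit_map:
  assumes "A \<in> sets borel"
  shows "measure \<mu> A = (\<Sum>g\<in>G. P g * measure \<mu> (digit_map n m (fst g) (snd g) -` A))"
proof -
  have "digit_map n m i j \<in> measurable \<mu> borel" for i j
    using digit_map_measurable[of i j] measurable_cong_sets[OF sets_mu refl] by auto
  then show ?thesis using self_affine[OF assms] assms by (simp add: measure_distr)
qed

text \<open>Self-affinity iterated \<open>L\<close> times; this carries the estimates for random
  words over to \<open>\<mu>\<close>.\<close>

lemma measure_avg:
  "A \<in> sets borel \<Longrightarrow> measure \<mu> A = avg L (\<lambda>w. measure \<mu> (word_map w -` A))"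
proof (induction L arbitrary: A)
  case 0
  then show ?case by (simp add: vimage_def)
next
  case (Suc L)
  have "measure \<mu> (digit_map n m (fst g) (snd g) -` A) =
      avg L (\<lambda>w. measure \<mu> (word_map (g # w) -` A))" for g
  proof -
    have "digit_map n m (fst g) (snd g) -` A \<in> sets borel"
      using measurable_sets[OF digit_map_measurable Suc.prems] by simp
    from Suc.IH[OF this] show ?thesis by (simp add: vimage_def)
  qed
  then show ?case using measure_digit_map[OF Suc.prems] by simp
qed

definition box_nbhd :: "real \<Rightarrow> (real \<times> real) set" where
  "box_nbhd t = {-t..1 + t} \<times> {-t..1 + t}"

lemma box_nbhd_borel [measurable]: "box_nbhd t \<in> sets borel"
  unfolding box_nbhd_def by (intro borel_closed closed_Times) auto

text \<open>Every digit map shrinks the excess beyond the unit square by at least the factor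
  \<open>m\<close>, hence sends the larger box into the smaller one.\<close>

lemma measure_box_scale:
  assumes "0 \<le> t"
  shows "measure \<mu> (box_nbhd (real m * t)) \<le> measure \<mu> (box_nbhd t)"
proof -
  have sub: "box_nbhd (real m * t) \<subseteq> digit_map n m (fst g) (snd g) -` box_nbhd t" if g: "g \<in> G" for g
  proof
    fix z assume z: "z \<in> box_nbhd (real m * t)"
    have d: "real (fst g) + 1 \<le> real n" "real (snd g) + 1 \<le> real m"
      using g G_digits by auto
    have mt: "real m * t \<le> real n * t" using n_ge assms by (intro mult_right_mono) auto
    have z': "- (real m * t) \<le> fst z" "fst z \<le> 1 + real m * t" "- (real m * t) \<le> snd z" "snd z \<le> 1 + real m * t"
      using z by (auto simp: box_nbhd_def)
    have "- t * real n \<le> fst z + real (fst g)" "fst z + real (fst g) \<le> (1 + t) * real n"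
      "- t * real m \<le> snd z + real (snd g)" "snd z + real (snd g) \<le> (1 + t) * real m"
      using z' d mt by (simp_all add: algebra_simps)
    then show "z \<in> digit_map n m (fst g) (snd g) -` box_nbhd t"
      using pos by (simp add: digit_map_eq box_nbhd_def pos_le_divide_eq pos_divide_le_eq)
  qed
  have "measure \<mu> (box_nbhd (real m * t)) = (\<Sum>g\<in>G. P g * measure \<mu> (box_nbhd (real m * t)))"
    by (simp add: P_sum flip: sum_distrib_right)
  also have "\<dots> \<le> (\<Sum>g\<in>G. P g * measure \<mu> (digit_map n m (fst g) (snd g) -` box_nbhd t))"
  proof (intro sum_mono mult_left_mono)
    fix g assume g: "g \<in> G"
    have "digit_map n m (fst g) (snd g) -` box_nbhd t \<in> sets \<mu>"
      using measurable_sets[OF digit_map_measurable box_nbhd_borel] by (simp add: sets_mu)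
    then show "measure \<mu> (box_nbhd (real m * t)) \<le> measure \<mu> (digit_map n m (fst g) (snd g) -` box_nbhd t)"
      using sub[OF g] by (intro finite_measure_mono) auto
    show "0 \<le> P g" using P_pos[OF g] by simp
  qed
  also have "\<dots> = measure \<mu> (box_nbhd t)"
    by (rule measure_digit_map[symmetric]) simp
  finally show ?thesis .
qed

text \<open>The boxes with excess \<open>m^k\<close> exhaust the plane, yet none has more mass than
  the first. This takes the place of a statement about the support of \<open>\<mu>\<close>.\<close>

lemma measure_box: "measure \<mu> (box_nbhd 1) = 1"
proof (rule antisym[OF prob_le_1])
  have le: "measure \<mu> (box_nbhd (real m ^ k)) \<le> measure \<mu> (box_nbhd 1)" for k
  proof (induction k)
    case (Suc k)
    then show ?case using measure_box_scale[of "real m ^ k"] by simp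
  qed simp
  have "(\<lambda>k. measure \<mu> (box_nbhd (real m ^ k))) \<longlonglongrightarrow> measure \<mu> (\<Union>k. box_nbhd (real m ^ k))"
  proof (rule finite_Lim_measure_incseq)
    show "range (\<lambda>k. box_nbhd (real m ^ k)) \<subseteq> sets \<mu>" by (auto simp: sets_mu)
    show "incseq (\<lambda>k. box_nbhd (real m ^ k))"
    proof (rule incseq_SucI)
      fix k
      have "real m ^ k \<le> real m ^ Suc k" using m_ge by (intro power_increasing) auto
      then show "box_nbhd (real m ^ k) \<subseteq> box_nbhd (real m ^ Suc k)"
        unfolding box_nbhd_def by (intro Sigma_mono) auto
    qed
  qed
  moreover have "(\<Union>k. box_nbhd (real m ^ k)) = UNIV"
  proof (intro equalityI subsetI UNIV_I)
    fix z :: "real \<times> real"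
    obtain k where "max \<bar>fst z\<bar> \<bar>snd z\<bar> < real m ^ k"
      using real_arch_pow[of "real m" "max \<bar>fst z\<bar> \<bar>snd z\<bar>"] m_ge by force
    then have "z \<in> box_nbhd (real m ^ k)"
      by (auto simp: box_nbhd_def mem_Times_iff)
    then show "z \<in> (\<Union>k. box_nbhd (real m ^ k))" by blast
  qed
  ultimately have "(\<lambda>k. measure \<mu> (box_nbhd (real m ^ k))) \<longlonglongrightarrow> 1"
    using prob_space by simp
  then show "1 \<le> measure \<mu> (box_nbhd 1)"
    by (rule LIMSEQ_le_const2) (use le in auto)
qed

text \<open>In units of the level, the omitted digits contribute at most 1 and the coordinates of
  \<open>z\<close>, which lie in \<open>[-1, 2]\<close>, at most 2.\<close>

lemma word_map_near_corner:
  assumes w: "w \<in> words M" and k: "k \<le> M" and z: "z \<in> box_nbhd 1"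
  shows "\<bar>digits_frac n (fst (code k w)) - fst (word_map w z)\<bar> \<le> 3 / real n ^ lev k"
    "\<bar>digits_frac m (snd (code k w)) - snd (word_map w z)\<bar> \<le> 3 / real m ^ k"
proof -
  have len: "length w = M" using w by (simp add: words_def)
  have gen: "\<bar>digits_frac b (map f (take l w)) - (digits_frac b (map f w) + x / real b ^ length w)\<bar>
      \<le> 3 / real b ^ l"
    if b: "1 \<le> b" and f: "set (map f w) \<subseteq> {..<b}" and x: "-1 \<le> x" "x \<le> 2" and l: "l \<le> M" for b f x l
  proof -
    define y where "y = digits_frac b (map f (drop l w))"
    define u where "u = x / real b ^ (M - l)"
    have "digits_frac b (map f w) = digits_frac b (map f (take l w) @ map f (drop l w))"
      by (metis append_take_drop_id map_append)
    also have "\<dots> = digits_frac b (map f (take l w)) + y / real b ^ l"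
      using b l len by (subst digits_frac_append) (auto simp: y_def)
    also have "x / real b ^ length w = u / real b ^ l"
      using l b by (simp add: u_def len flip: power_add)
    ultimately have "digits_frac b (map f (take l w)) - (digits_frac b (map f w) + x / real b ^ length w)
        = - (y + u) / real b ^ l"
      by (simp add: add_divide_distrib diff_divide_distrib)
    moreover have "\<bar>y + u\<bar> \<le> 3"
    proof -
      have "set (map f (drop l w)) \<subseteq> {..<b}" using f set_drop_subset[of l w] by fastforce
      then have y: "0 \<le> y" "y \<le> 1"
        unfolding y_def using digits_frac_nonneg digits_frac_le_1 by blast+
      have "\<bar>u\<bar> \<le> \<bar>x\<bar>" using b by (simp add: u_def abs_divide divide_le_eq mult_le_cancel_left1)
      then show ?thesis using x y by linarith
    qed
    ultimately show ?thesis using b by (simp add: abs_divide divide_right_mono)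
  qed
  have zc: "-1 \<le> fst z" "fst z \<le> 2" "-1 \<le> snd z" "snd z \<le> 2"
    using z by (auto simp: box_nbhd_def)
  show "\<bar>digits_frac n (fst (code k w)) - fst (word_map w z)\<bar> \<le> 3 / real n ^ lev k"
    unfolding word_map_coords code_def fst_conv
    using pos word_digits[OF w] zc k lev_le[of k] by (intro gen) auto
  show "\<bar>digits_frac m (snd (code k w)) - snd (word_map w z)\<bar> \<le> 3 / real m ^ k"
    unfolding word_map_coords code_def snd_conv
    using pos word_digits[OF w] zc k by (intro gen) auto
qed

section \<open>Neighbourhoods of a finite set, and the set of heavy corners\<close>

definition nbhd :: "(real \<times> real) set \<Rightarrow> nat \<Rightarrow> (real \<times> real) set" where
  "nbhd \<alpha> k = {x. infdist x \<alpha> \<le> 1 / real m ^ k}"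

lemma nbhd_borel [measurable]: "nbhd \<alpha> k \<in> sets borel"
  unfolding nbhd_def
  by (intro borel_closed closed_Collect_le continuous_on_infdist continuous_on_id continuous_on_const)

lemma measure_eq_0_off_box:
  assumes "A \<in> sets borel" "A \<inter> box_nbhd 1 = {}"
  shows "measure \<mu> A = 0"
proof -
  have "measure \<mu> A \<le> measure \<mu> (space \<mu> - box_nbhd 1)"
    using assms by (intro finite_measure_mono) (auto simp: sets_mu)
  also have "\<dots> = 0" by (subst prob_compl) (auto simp: sets_mu measure_box)
  finally show ?thesis using measure_nonneg[of \<mu> A] by linarith
qed

text \<open>An image point of the box lies within 3 units of its corner. If it is also within
  \<open>1 / m^k\<close> of \<open>a\<close>, the corner is within 3 + 1 = 4 units of
  \<open>a\<close>, which is \<open>near\<close>; so a word that is not near \<open>\<alpha>\<close>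
  contributes mass zero.\<close>

lemma measure_nbhd_le:
  assumes \<alpha>: "finite \<alpha>" "\<alpha> \<noteq> {}" and k: "k \<le> M"
  shows "measure \<mu> (nbhd \<alpha> k) \<le> avg M (\<lambda>w. of_bool (\<exists>a\<in>\<alpha>. near k (code k w) a))"
  unfolding measure_avg[OF nbhd_borel, of \<alpha> k M]
proof (rule avg_mono)
  fix w assume w: "w \<in> words M"
  show "measure \<mu> (word_map w -` nbhd \<alpha> k) \<le> of_bool (\<exists>a\<in>\<alpha>. near k (code k w) a)"
  proof (cases "\<exists>a\<in>\<alpha>. near k (code k w) a")
    case False
    have "word_map w -` nbhd \<alpha> k \<inter> box_nbhd 1 = {}"
    proof (intro equals0I)
      fix z assume z: "z \<in> word_map w -` nbhd \<alpha> k \<inter> box_nbhd 1"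
      obtain a where a: "a \<in> \<alpha>" "infdist (word_map w z) \<alpha> = dist (word_map w z) a"
        using infdist_attains_inf[of \<alpha>] \<alpha> finite_imp_closed by metis
      have d: "dist (word_map w z) a \<le> 1 / real m ^ k" using z a(2) by (simp add: nbhd_def)
      have "1 / real m ^ k \<le> 1 / real n ^ lev k"
        using n_lev_le[of k] pos by (intro divide_left_mono) auto
      then have "\<bar>fst (word_map w z) - fst a\<bar> \<le> 1 / real n ^ lev k"
        "\<bar>snd (word_map w z) - snd a\<bar> \<le> 1 / real m ^ k"
        using d dist_fst_le[of "word_map w z" a] dist_snd_le[of "word_map w z" a]
        by (auto simp: dist_real_def)
      then have "near k (code k w) a"
        using word_map_near_corner[OF w k, of z] z
        unfolding near_def by (auto simp: abs_le_iff field_simps)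
      then show False using False a(1) by blast
    qed
    then show ?thesis using measure_eq_0_off_box[OF word_map_vimage[OF nbhd_borel]] by simp
  qed simp
qed

definition corner :: "nat list \<times> nat list \<Rightarrow> real \<times> real" where
  "corner c = (digits_frac n (fst c), digits_frac m (snd c))"

definition heavy_corners :: "nat \<Rightarrow> real \<Rightarrow> (real \<times> real) set" where
  "heavy_corners M T = (\<Union>k<M. corner ` heavy M T k)"

lemma finite_heavy_corners: "finite (heavy_corners M T)"
  by (simp add: heavy_corners_def finite_heavy)

lemma card_heavy_corners: "real (card (heavy_corners M T)) \<le> heavy_const * exp T"
proof -
  have "card (heavy_corners M T) \<le> (\<Sum>k<M. card (corner ` heavy M T k))"
    unfolding heavy_corners_def by (rule card_UN_le) simp
  also have "\<dots> \<le> (\<Sum>k<M. card (heavy M T k))"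
    by (intro sum_mono card_image_le finite_heavy)
  finally have "real (card (heavy_corners M T)) \<le> real (\<Sum>k<M. card (heavy M T k))"
    by (rule of_nat_mono)
  then show ?thesis using sum_card_heavy[of M T] by simp
qed

text \<open>Number of levels given up so that a square of level \<open>j + shift\<close>, whose
  points lie within \<open>(3 * n + 3) / m^(j + shift)\<close> of its corner, stays within
  \<open>1 / m^j\<close> of that corner.\<close>

definition shift :: nat where "shift = 3 * n + 3"

lemma shift_bound: "3 * real n + 3 \<le> real m ^ shift"
proof -
  have "shift < 2 ^ shift" by (rule less_exp)
  also have "2 ^ shift \<le> m ^ shift" using m_ge by (intro power_mono) auto
  finally have "real shift \<le> real (m ^ shift)" by (intro of_nat_mono) simp
  then show ?thesis by (simp add: shift_def)
qed

text \<open>For a word heavy at level \<open>j + shift\<close>, the whole image of the box lies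
  within \<open>1 / m^j\<close> of a heavy corner, so the word contributes full mass.\<close>

lemma measure_nbhd_heavy_ge:
  assumes k: "j + shift < M"
  shows "avg M (\<lambda>w. of_bool (V (j + shift) w \<le> T)) \<le> measure \<mu> (nbhd (heavy_corners M T) j)"
  unfolding measure_avg[OF nbhd_borel, of _ j M]
proof (rule avg_mono)
  fix w assume w: "w \<in> words M"
  define k where "k = j + shift"
  have kM: "k < M" using k by (simp add: k_def)
  show "of_bool (V (j + shift) w \<le> T) \<le> measure \<mu> (word_map w -` nbhd (heavy_corners M T) j)"
  proof (cases "V k w \<le> T")
    case True
    define a where "a = corner (code k w)"
    have a: "a \<in> heavy_corners M T"
      using heavy_iff[OF w, of k T] True kM by (auto simp: a_def heavy_corners_def)
    have "box_nbhd 1 \<subseteq> word_map w -` nbhd (heavy_corners M T) j"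
    proof
      fix z assume z: "z \<in> box_nbhd 1"
      have "infdist (word_map w z) (heavy_corners M T) \<le> dist (word_map w z) a"
        using a by (rule infdist_le)
      also have "\<dots> \<le> \<bar>fst (word_map w z) - fst a\<bar> + \<bar>snd (word_map w z) - snd a\<bar>"
        using sqrt_sum_squares_le_sum_abs by (simp add: dist_prod_def dist_real_def)
      also have "\<dots> \<le> 3 / real n ^ lev k + 3 / real m ^ k"
        using word_map_near_corner[OF w _ z, of k] kM
        by (intro add_mono) (auto simp: a_def corner_def abs_minus_commute)
      also have "3 / real n ^ lev k \<le> 3 * real n / real m ^ k"
        using m_pow_le[of k] pos by (simp add: field_simps)
      also have "3 * real n / real m ^ k + 3 / real m ^ k = (3 * real n + 3) / real m ^ k"
        by (simp add: add_divide_distrib)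
      also have "\<dots> \<le> real m ^ shift / real m ^ k"
        by (intro divide_right_mono shift_bound) simp
      also have "\<dots> = 1 / real m ^ j" using pos by (simp add: k_def power_add)
      finally show "z \<in> word_map w -` nbhd (heavy_corners M T) j" by (simp add: nbhd_def)
    qed
    then have "measure \<mu> (box_nbhd 1) \<le> measure \<mu> (word_map w -` nbhd (heavy_corners M T) j)"
      by (intro finite_measure_mono) (auto simp: sets_mu word_map_vimage)
    then show ?thesis by (simp add: measure_box)
  qed (simp add: k_def)
qed

end

section \<open>Quantization coefficients\<close>

lemma exp_ereal_mono: "x \<le> y \<Longrightarrow> exp_ereal x \<le> exp_ereal y"
  by (cases x; cases y) (auto simp: exp_ereal_def)

lemma exp_ereal_real [simp]: "exp_ereal (ereal r) = ereal (exp r)"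
  by (simp add: exp_ereal_def)

text \<open>With \<open>q = - ln d / ln m\<close> nonnegative, the levels from 0 to the floor of
  \<open>q\<close> all satisfy \<open>d \<le> 1 / m^k\<close>, and there are more than
  \<open>q\<close> of them.\<close>

lemma log_ereal_le_levels:
  assumes m: "2 \<le> m" and d: "0 \<le> d"
  shows "e2ennreal (- log_ereal d) \<le> (\<Sum>k. ennreal (ln (real m)) * indicator {k. d \<le> 1 / real m ^ k} k)"
    (is "_ \<le> suminf ?f")
proof -
  have lm: "0 < ln (real m)" using m by simp
  have partial: "of_nat K * ennreal (ln (real m)) \<le> suminf ?f"
    if "\<And>k. k < K \<Longrightarrow> d \<le> 1 / real m ^ k" for K
  proof -
    have "of_nat K * ennreal (ln (real m)) = (\<Sum>k<K. ?f k)"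
      using that by (simp add: indicator_def)
    also have "\<dots> \<le> suminf ?f" by (intro sum_le_suminf) auto
    finally show ?thesis .
  qed
  show ?thesis
  proof (cases "d = 0")
    case True
    \<comment> \<open>For \<open>d = 0\<close> every level counts and the series diverges, matching
      the infinite left-hand side.\<close>
    have "(SUP K. of_nat K * ennreal (ln (real m))) \<le> suminf ?f"
      by (intro SUP_least partial) (simp add: True)
    moreover have "(SUP K. of_nat K * ennreal (ln (real m))) = top"
      using lm by (subst SUP_mult_right_ennreal[symmetric])
        (auto simp: ennreal_SUP_of_nat_eq_top ennreal_top_mult)
    ultimately show ?thesis by (simp add: top.extremum_unique)
  next
    case False
    with d have d: "0 < d" by simp
    then have log: "- log_ereal d = ereal (- ln d)" by (simp add: log_ereal_def)
    show ?thesis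
    proof (cases "1 < d")
      case True
      \<comment> \<open>For \<open>1 < d\<close> the logarithm enters only the positive
        part.\<close>
      then have "e2ennreal (- log_ereal d) = 0"
        unfolding log by (intro e2ennreal_neg) simp
      then show ?thesis by simp
    next
      case False
      define q where "q = - ln d / ln (real m)"
      have q: "0 \<le> q" unfolding q_def using False d lm by (intro divide_nonneg_pos) auto
      define K where "K = Suc (nat \<lfloor>q\<rfloor>)"
      have "d \<le> 1 / real m ^ k" if "k < K" for k
      proof -
        have "real k \<le> q" using that q unfolding K_def by linarith
        then have "real k * ln (real m) \<le> - ln d"
          unfolding q_def by (subst (asm) pos_le_divide_eq[OF lm])
        then have "ln (real m ^ k) \<le> - ln d"
          using m by (simp add: ln_realpow)
        then have "ln (real m ^ k) \<le> ln (1 / d)" using d by (simp add: ln_div)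
        then have "real m ^ k \<le> 1 / d" using d m by (subst (asm) ln_le_cancel_iff) auto
        then show ?thesis using d m by (simp add: field_simps)
      qed
      then have "of_nat K * ennreal (ln (real m)) \<le> suminf ?f" by (rule partial)
      moreover have "e2ennreal (- log_ereal d) \<le> of_nat K * ennreal (ln (real m))"
      proof -
        have "q \<le> real K" using q unfolding K_def by linarith
        then have "- ln d \<le> real K * ln (real m)"
          unfolding q_def by (subst (asm) pos_divide_le_eq[OF lm])
        then have "ennreal (- ln d) \<le> ennreal (real K * ln (real m))" by (rule ennreal_leI)
        also have "\<dots> = of_nat K * ennreal (ln (real m))"
          using lm by (simp add: ennreal_mult ennreal_of_nat_eq_real_of_nat)
        finally show ?thesis unfolding log by simp
      qed
      ultimately show ?thesis by (rule order_trans[rotated])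
    qed
  qed
qed

text \<open>Counting from 1, the number of admissible levels is at most the largest of them, and
  that level times \<open>ln m\<close> is at most \<open>- ln d\<close>.\<close>

lemma levels_le_log_ereal:
  assumes m: "2 \<le> m" and d: "0 \<le> d"
  shows "(\<Sum>k\<in>{1..J}. ennreal (ln (real m)) * indicator {k. d \<le> 1 / real m ^ k} k)
    \<le> e2ennreal (- log_ereal d)"
proof (cases "d = 0")
  case True
  then show ?thesis by (simp add: log_ereal_def)
next
  case False
  with d have d: "0 < d" by simp
  have lm: "0 < ln (real m)" using m by simp
  have log: "e2ennreal (- log_ereal d) = ennreal (- ln d)" using d by (simp add: log_ereal_def)
  define S where "S = {k \<in> {1..J}. d \<le> 1 / real m ^ k}"
  have eq: "(\<Sum>k\<in>{1..J}. ennreal (ln (real m)) * indicator {k. d \<le> 1 / real m ^ k} k) =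
      ennreal (real (card S) * ln (real m))"
  proof -
    have "(\<Sum>k\<in>{1..J}. ennreal (ln (real m)) * indicator {k. d \<le> 1 / real m ^ k} k) =
        (\<Sum>k\<in>S. ennreal (ln (real m)))"
      unfolding S_def by (intro sum.mono_neutral_cong_right) auto
    then show ?thesis using lm by (simp add: ennreal_mult ennreal_of_nat_eq_real_of_nat)
  qed
  show ?thesis
  proof (cases "S = {}")
    case True
    then show ?thesis unfolding eq by simp
  next
    case False
    have fS: "finite S" by (simp add: S_def)
    define k where "k = Max S"
    have k: "k \<in> S" unfolding k_def using fS False by (rule Max_in)
    have "card S \<le> card {1..k}"
      using fS by (intro card_mono) (auto simp: k_def S_def)
    then have "real (card S) * ln (real m) \<le> real k * ln (real m)"
      using lm by (intro mult_right_mono) auto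
    also have "\<dots> = ln (real m ^ k)" using m by (simp add: ln_realpow)
    also have "\<dots> \<le> ln (1 / d)"
    proof -
      have "real m ^ k \<le> 1 / d" using k d m by (simp add: S_def field_simps)
      then show ?thesis using d m by (subst ln_le_cancel_iff) auto
    qed
    also have "\<dots> = - ln d" using d by (simp add: ln_div)
    finally show ?thesis unfolding eq log by (rule ennreal_leI)
  qed
qed

context carpet_measure
begin

lemma words_nonempty: "words M \<noteq> {}"
proof -
  obtain g where "g \<in> G" using card_G by (metis all_not_in_conv card.empty not_numeral_le_zero)
  then have "replicate M g \<in> words M" by (auto simp: words_def)
  then show ?thesis by blast
qed

section \<open>The negative part of the logarithmic integral as a sum over levels\<close>

definition neg_log_integral :: "(real \<times> real) set \<Rightarrow> ennreal" where
  "neg_log_integral \<alpha> = (\<integral>\<^sup>+ x. e2ennreal (- log_ereal (infdist x \<alpha>)) \<partial>\<mu>)"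

lemma nbhd_sets [measurable]: "nbhd \<alpha> k \<in> sets \<mu>"
  by (simp add: sets_mu)

lemma nn_integral_level:
  "(\<integral>\<^sup>+ x. ennreal (ln (real m)) * indicator {k. infdist x \<alpha> \<le> 1 / real m ^ k} k \<partial>\<mu>) =
    ennreal (ln (real m) * measure \<mu> (nbhd \<alpha> k))"
proof -
  have "(\<integral>\<^sup>+ x. ennreal (ln (real m)) * indicator {k. infdist x \<alpha> \<le> 1 / real m ^ k} k \<partial>\<mu>) =
      (\<integral>\<^sup>+ x. ennreal (ln (real m)) * indicator (nbhd \<alpha> k) x \<partial>\<mu>)"
    by (intro nn_integral_cong) (simp add: nbhd_def indicator_def)
  also have "\<dots> = ennreal (ln (real m)) * emeasure \<mu> (nbhd \<alpha> k)"
    by (rule nn_integral_cmult_indicator) (rule nbhd_sets)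
  also have "\<dots> = ennreal (ln (real m) * measure \<mu> (nbhd \<alpha> k))"
    using ln_m_pos by (simp add: emeasure_eq_measure ennreal_mult)
  finally show ?thesis .
qed

lemma level_measurable:
  "(\<lambda>x. ennreal (ln (real m)) * indicator {k. infdist x \<alpha> \<le> 1 / real m ^ k} k) \<in> borel_measurable \<mu>"
proof -
  have "(\<lambda>x. ennreal (ln (real m)) * indicator {k. infdist x \<alpha> \<le> 1 / real m ^ k} k) =
      (\<lambda>x. ennreal (ln (real m)) * indicator (nbhd \<alpha> k) x)"
    by (auto simp: nbhd_def indicator_def)
  then show ?thesis by simp
qed

lemma neg_log_integral_le:
  assumes "\<And>M. (\<Sum>k<M. measure \<mu> (nbhd \<alpha> k)) \<le> B"
  shows "neg_log_integral \<alpha> \<le> ennreal (ln (real m) * B)"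
proof -
  have "neg_log_integral \<alpha> \<le>
      (\<integral>\<^sup>+ x. (\<Sum>k. ennreal (ln (real m)) * indicator {k. infdist x \<alpha> \<le> 1 / real m ^ k} k) \<partial>\<mu>)"
    unfolding neg_log_integral_def
    by (intro nn_integral_mono log_ereal_le_levels m_ge infdist_nonneg)
  also have "\<dots> = (\<Sum>k. ennreal (ln (real m) * measure \<mu> (nbhd \<alpha> k)))"
    by (subst nn_integral_suminf[OF level_measurable]) (simp only: nn_integral_level)
  also have "\<dots> \<le> ennreal (ln (real m) * B)"
  proof (rule suminf_le_const[OF summableI])
    fix M
    have "(\<Sum>k<M. ennreal (ln (real m) * measure \<mu> (nbhd \<alpha> k))) =
        ennreal (ln (real m) * (\<Sum>k<M. measure \<mu> (nbhd \<alpha> k)))"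
      using ln_m_pos by (simp add: sum_distrib_left)
    also have "\<dots> \<le> ennreal (ln (real m) * B)"
      using assms ln_m_pos by (intro ennreal_leI mult_left_mono) auto
    finally show "(\<Sum>k<M. ennreal (ln (real m) * measure \<mu> (nbhd \<alpha> k))) \<le> ennreal (ln (real m) * B)" .
  qed
  finally show ?thesis .
qed

lemma neg_log_integral_ge:
  "ennreal (ln (real m) * (\<Sum>k\<in>{1..J}. measure \<mu> (nbhd \<alpha> k))) \<le> neg_log_integral \<alpha>"
proof -
  have "ennreal (ln (real m) * (\<Sum>k\<in>{1..J}. measure \<mu> (nbhd \<alpha> k))) =
      (\<Sum>k\<in>{1..J}. ennreal (ln (real m) * measure \<mu> (nbhd \<alpha> k)))"
    using ln_m_pos by (simp add: sum_distrib_left)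
  also have "\<dots> = (\<integral>\<^sup>+ x. (\<Sum>k\<in>{1..J}. ennreal (ln (real m)) * indicator {k. infdist x \<alpha> \<le> 1 / real m ^ k} k) \<partial>\<mu>)"
    by (subst nn_integral_sum[OF level_measurable]) (simp only: nn_integral_level)
  also have "\<dots> \<le> neg_log_integral \<alpha>"
    unfolding neg_log_integral_def
    by (intro nn_integral_mono levels_le_log_ereal m_ge infdist_nonneg)
  finally show ?thesis .
qed

section \<open>Two-sided bounds for the logarithmic integral\<close>

lemma exists_level: "\<exists>M\<ge>N. T < slope * real M - gap"
proof -
  obtain M0 :: nat where "(T + gap) / slope < real M0" using reals_Archimedean2 by blast
  also have "real M0 \<le> real (max N M0)" by simp
  finally have "T < slope * real (max N M0) - gap" using slope_pos by (simp add: field_simps)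
  then show ?thesis by (intro exI[of _ "max N M0"]) simp
qed

definition lower_const :: real where
  "lower_const = ln (real m) * (stop_const / entropy_rate + 578 * heavy_const)"

text \<open>The negative part is at most \<open>ln m\<close> times the expected number of levels at
  which the square is near \<open>\<alpha>\<close>, hence times the expected number of heavy levels
  up to a constant. The positive part is bounded below by 0.\<close>

lemma log_dist_integral_ge:
  assumes \<alpha>: "finite \<alpha>" "1 \<le> card \<alpha>" "real (card \<alpha>) \<le> exp T" and T: "0 \<le> T"
  shows "ereal (- (ln (real m) / entropy_rate * T + lower_const)) \<le> log_dist_integral \<mu> \<alpha>"
proof -
  have ne: "\<alpha> \<noteq> {}" using \<alpha>(2) by auto
  define B where "B = (T + stop_const) / entropy_rate + 578 * heavy_const"
  have "(\<Sum>k<N. measure \<mu> (nbhd \<alpha> k)) \<le> B" for N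
  proof -
    obtain M where M: "N \<le> M" "T < slope * real M - gap" using exists_level by blast
    have "(\<Sum>k<N. measure \<mu> (nbhd \<alpha> k)) \<le> (\<Sum>k<M. measure \<mu> (nbhd \<alpha> k))"
      using M(1) by (intro sum_mono2) auto
    also have "\<dots> \<le> (\<Sum>k<M. avg M (\<lambda>w. of_bool (\<exists>a\<in>\<alpha>. near k (code k w) a)))"
      by (intro sum_mono measure_nbhd_le \<alpha>(1) ne) auto
    also have "\<dots> \<le> stop_avg M T + 578 * heavy_const"
      by (rule near_sum_le[OF \<alpha>(1,3)])
    also have "stop_avg M T \<le> (T + stop_const) / entropy_rate"
      using stop_avg_estimate[OF T M(2)] entropy_rate_pos
      by (simp add: pos_le_divide_eq abs_le_iff mult.commute)
    finally show ?thesis by (simp add: B_def)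
  qed
  then have "neg_log_integral \<alpha> \<le> ennreal (ln (real m) * B)"
    by (rule neg_log_integral_le)
  moreover have "ln (real m) * B = ln (real m) / entropy_rate * T + lower_const"
    using entropy_rate_pos by (simp add: B_def lower_const_def field_simps)
  moreover have "0 \<le> B"
    using \<open>\<And>N. (\<Sum>k<N. measure \<mu> (nbhd \<alpha> k)) \<le> B\<close>[of 0] by simp
  ultimately have "enn2ereal (neg_log_integral \<alpha>) \<le> ereal (ln (real m) / entropy_rate * T + lower_const)"
    using ln_m_pos by (metis enn2ereal_ennreal less_eq_ennreal.rep_eq mult_nonneg_nonneg less_imp_le)
  then have "0 - ereal (ln (real m) / entropy_rate * T + lower_const) \<le>
      enn2ereal (\<integral>\<^sup>+ x. e2ennreal (log_ereal (infdist x \<alpha>)) \<partial>\<mu>) - enn2ereal (neg_log_integral \<alpha>)"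
    by (intro ereal_minus_mono enn2ereal_nonneg)
  then show ?thesis by (simp add: log_dist_integral_def neg_log_integral_def)
qed

lemma heavy_corners_nonempty:
  assumes "0 < M" "0 \<le> T"
  shows "heavy_corners M T \<noteq> {}"
proof -
  obtain w where "w \<in> words M" using words_nonempty by blast
  then have "code 0 w \<in> heavy M T 0" using assms by (simp add: heavy_iff)
  then show ?thesis using assms(1) unfolding heavy_corners_def by blast
qed

lemma infdist_heavy_corners_le:
  assumes x: "x \<in> box_nbhd 1" and ne: "heavy_corners M T \<noteq> {}"
  shows "infdist x (heavy_corners M T) \<le> 4"
proof -
  obtain a where a: "a \<in> heavy_corners M T" using ne by blast
  then obtain k w where w: "k < M" "w \<in> words M" "a = corner (code k w)"
    by (auto simp: heavy_corners_def heavy_def)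
  have ab: "0 \<le> fst a" "fst a \<le> 1" "0 \<le> snd a" "snd a \<le> 1"
    using w code_digits(1,2)[OF w(2), of k] digits_frac_nonneg digits_frac_le_1 by (auto simp: corner_def)
  have "infdist x (heavy_corners M T) \<le> dist x a" using a by (rule infdist_le)
  also have "\<dots> \<le> \<bar>fst x - fst a\<bar> + \<bar>snd x - snd a\<bar>"
    using sqrt_sum_squares_le_sum_abs by (simp add: dist_prod_def dist_real_def)
  \<comment> \<open>At most 2 per coordinate, as \<open>x\<close> has coordinates in
    \<open>[-1, 2]\<close> and corners have theirs in \<open>[0, 1]\<close>.\<close>
  also have "\<dots> \<le> 4" using x ab by (auto simp: box_nbhd_def mem_Times_iff)
  finally show ?thesis .
qed

text \<open>\<open>ln 4\<close> bounds the positive part, and \<open>shift + 1\<close> counts the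
  levels lost in passing from heavy squares to neighbourhoods.\<close>

definition upper_const :: real where
  "upper_const = ln 4 + ln (real m) * (stop_const / entropy_rate + real shift + 1)"

text \<open>The heavy corners are the witness: each heavy level past the first
  \<open>shift + 1\<close> adds \<open>ln m\<close> to the negative part.\<close>

lemma exists_log_dist_integral_le:
  assumes T: "0 \<le> T"
  shows "\<exists>\<alpha>. finite \<alpha> \<and> 1 \<le> card \<alpha> \<and> real (card \<alpha>) \<le> heavy_const * exp T \<and>
    log_dist_integral \<mu> \<alpha> \<le> ereal (- (ln (real m) / entropy_rate * T) + upper_const)"
proof -
  obtain M where M: "Suc shift \<le> M" "T < slope * real M - gap" using exists_level by blast
  \<comment> \<open>Levels \<open>shift + 1\<close> to \<open>M - 1\<close> correspond to
    \<open>j\<close> from 1 to \<open>J\<close>; the first \<open>shift + 1\<close> levels are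
    discarded at a cost of at most 1 each.\<close>
  define J where "J = M - Suc shift"
  have MJ: "M = Suc shift + J" using M(1) by (simp add: J_def)
  define \<alpha> where "\<alpha> = heavy_corners M T"
  have ne: "\<alpha> \<noteq> {}" unfolding \<alpha>_def using M(1) T by (intro heavy_corners_nonempty) auto
  have fin: "finite \<alpha>" unfolding \<alpha>_def by (rule finite_heavy_corners)
  define S where "S = (\<Sum>k\<in>{1..J}. measure \<mu> (nbhd \<alpha> k))"
  have "stop_avg M T = (\<Sum>k<Suc shift. avg M (\<lambda>w. of_bool (V k w \<le> T))) +
      (\<Sum>k=Suc shift..<M. avg M (\<lambda>w. of_bool (V k w \<le> T)))"
    unfolding stop_avg_def using M(1) by (simp only: lessThan_atLeast0 sum.atLeastLessThan_concat)
  also have "(\<Sum>k<Suc shift. avg M (\<lambda>w. of_bool (V k w \<le> T))) \<le> (\<Sum>k<Suc shift. 1)"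
  proof (intro sum_mono)
    fix k
    show "avg M (\<lambda>w. of_bool (V k w \<le> T)) \<le> 1" using avg_mono[of M _ "\<lambda>_. 1"] by simp
  qed
  also have "(\<Sum>k=Suc shift..<M. avg M (\<lambda>w. of_bool (V k w \<le> T))) =
      (\<Sum>j=1..J. avg M (\<lambda>w. of_bool (V (j + shift) w \<le> T)))"
    using sum.shift_bounds_nat_ivl[of "\<lambda>k. avg M (\<lambda>w. of_bool (V k w \<le> T))" 1 shift "Suc J"]
    by (simp add: MJ atLeastLessThanSuc_atLeastAtMost add.commute)
  also have "\<dots> \<le> S"
    unfolding S_def \<alpha>_def by (intro sum_mono measure_nbhd_heavy_ge) (auto simp: MJ)
  finally have S: "stop_avg M T \<le> real shift + 1 + S" by simp
  have "(T - stop_const) / entropy_rate \<le> stop_avg M T"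
    using stop_avg_estimate[OF T M(2)] entropy_rate_pos
    by (simp add: pos_divide_le_eq abs_le_iff mult.commute)
  then have "ln (real m) * ((T - stop_const) / entropy_rate - (real shift + 1)) \<le> ln (real m) * S"
    using S ln_m_pos by (intro mult_left_mono) auto
  moreover have "ln (real m) * ((T - stop_const) / entropy_rate - (real shift + 1)) =
      ln (real m) / entropy_rate * T + ln 4 - upper_const"
    using entropy_rate_pos by (simp add: upper_const_def field_simps)
  ultimately have real_bound: "ln 4 - ln (real m) * S \<le> - (ln (real m) / entropy_rate * T) + upper_const"
    by linarith
  have S0: "0 \<le> ln (real m) * S" unfolding S_def using ln_m_pos by (intro mult_nonneg_nonneg sum_nonneg) auto
  have "ereal (ln (real m) * S) = enn2ereal (ennreal (ln (real m) * S))" using S0 by simp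
  also have "\<dots> \<le> enn2ereal (neg_log_integral \<alpha>)"
    using neg_log_integral_ge[where J = J and \<alpha> = \<alpha>] unfolding S_def less_eq_ennreal.rep_eq .
  finally have neg: "ereal (ln (real m) * S) \<le> enn2ereal (neg_log_integral \<alpha>)" .
  have "AE x in \<mu>. x \<in> box_nbhd 1"
    using measure_box by (intro prob_eq_1[THEN iffD1]) (auto simp: sets_mu)
  then have "AE x in \<mu>. e2ennreal (log_ereal (infdist x \<alpha>)) \<le> ennreal (ln 4)"
  proof (rule eventually_mono)
    fix x assume x: "x \<in> box_nbhd 1"
    have d: "infdist x \<alpha> \<le> 4" using infdist_heavy_corners_le[OF x] ne unfolding \<alpha>_def by blast
    have "log_ereal (infdist x \<alpha>) \<le> ereal (ln 4)"
      using d by (auto simp: log_ereal_def)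
    then show "e2ennreal (log_ereal (infdist x \<alpha>)) \<le> ennreal (ln 4)"
      using e2ennreal_mono by fastforce
  qed
  then have "(\<integral>\<^sup>+ x. e2ennreal (log_ereal (infdist x \<alpha>)) \<partial>\<mu>) \<le> (\<integral>\<^sup>+ x. ennreal (ln 4) \<partial>\<mu>)"
    by (rule nn_integral_mono_AE)
  also have "\<dots> = ennreal (ln 4)" by (simp add: emeasure_space_1[simplified])
  finally have "enn2ereal (\<integral>\<^sup>+ x. e2ennreal (log_ereal (infdist x \<alpha>)) \<partial>\<mu>) \<le> enn2ereal (ennreal (ln 4))"
    unfolding less_eq_ennreal.rep_eq .
  then have "log_dist_integral \<mu> \<alpha> \<le> ereal (ln 4) - ereal (ln (real m) * S)"
    unfolding log_dist_integral_def neg_log_integral_def[symmetric]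
    using neg by (intro ereal_minus_mono) auto
  then have "log_dist_integral \<mu> \<alpha> \<le> ereal (- (ln (real m) / entropy_rate * T) + upper_const)"
    using real_bound by (simp add: order_trans)
  moreover have "1 \<le> card \<alpha>" using ne fin by (simp add: Suc_le_eq card_gt_0_iff)
  moreover have "real (card \<alpha>) \<le> heavy_const * exp T" unfolding \<alpha>_def by (rule card_heavy_corners)
  ultimately show ?thesis using fin by blast
qed

section \<open>Scaled errors and quantization coefficients\<close>

definition dim :: real where "dim = entropy_rate / ln (real m)"

text \<open>At \<open>T = ln N\<close> this factor cancels the term linear in \<open>T\<close> in
  the bounds for the integral.\<close>

lemma powr_dim: "0 < N \<Longrightarrow> real N powr (1 / dim) = exp (ln (real m) / entropy_rate * ln (real N))"
  by (simp add: powr_def dim_def)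

lemma scaled_error_ge:
  assumes "1 \<le> N"
  shows "ereal (exp (- lower_const)) \<le> ereal (real N powr (1 / dim)) * geom_mean_error N \<mu>"
proof -
  let ?e = "ln (real m) / entropy_rate * ln (real N)"
  have "ereal (exp (- (?e + lower_const))) \<le> geom_mean_error N \<mu>"
    unfolding geom_mean_error_def
  proof (rule Inf_greatest)
    fix y assume "y \<in> {exp_ereal (log_dist_integral \<mu> \<alpha>) |\<alpha>. finite \<alpha> \<and> 1 \<le> card \<alpha> \<and> card \<alpha> \<le> N}"
    then obtain \<alpha> where \<alpha>: "y = exp_ereal (log_dist_integral \<mu> \<alpha>)" "finite \<alpha>" "1 \<le> card \<alpha>" "card \<alpha> \<le> N"
      by blast
    \<comment> \<open>Applied with \<open>T = ln N\<close>, so that \<open>exp T\<close> is the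
      permitted cardinality.\<close>
    have "ereal (- (?e + lower_const)) \<le> log_dist_integral \<mu> \<alpha>"
      using \<alpha> assms by (intro log_dist_integral_ge) auto
    then show "ereal (exp (- (?e + lower_const))) \<le> y"
      unfolding \<alpha>(1) using exp_ereal_mono exp_ereal_real by metis
  qed
  then have "ereal (real N powr (1 / dim)) * ereal (exp (- (?e + lower_const))) \<le>
      ereal (real N powr (1 / dim)) * geom_mean_error N \<mu>"
    by (rule ereal_mult_left_mono) simp
  moreover have "real N powr (1 / dim) * exp (- (?e + lower_const)) = exp (- lower_const)"
    using assms by (simp add: powr_dim flip: exp_add)
  ultimately show ?thesis by simp
qed

lemma scaled_error_le:
  assumes N: "heavy_const \<le> real N"
  shows "ereal (real N powr (1 / dim)) * geom_mean_error N \<mu> \<le>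
    ereal (exp (ln (real m) / entropy_rate * ln heavy_const + upper_const))"
proof -
  let ?e = "ln (real m) / entropy_rate"
  have pos: "0 < heavy_const" "0 < real N" using heavy_const_ge_1 N by auto
  \<comment> \<open>Chosen so that the bound \<open>heavy_const * exp T\<close> on the number of
    heavy corners equals \<open>N\<close>.\<close>
  define T where "T = ln (real N / heavy_const)"
  have T: "0 \<le> T" using N pos by (simp add: T_def)
  have eT: "heavy_const * exp T = real N" using pos by (simp add: T_def)
  have T': "T = ln (real N) - ln heavy_const" using pos by (simp add: T_def ln_div)
  obtain \<alpha> where \<alpha>: "finite \<alpha>" "1 \<le> card \<alpha>" "real (card \<alpha>) \<le> real N"
    "log_dist_integral \<mu> \<alpha> \<le> ereal (- (?e * T) + upper_const)"
    using exists_log_dist_integral_le[OF T] unfolding eT by blast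
  have "geom_mean_error N \<mu> \<le> exp_ereal (log_dist_integral \<mu> \<alpha>)"
    unfolding geom_mean_error_def using \<alpha> by (intro Inf_lower) auto
  also have "\<dots> \<le> ereal (exp (- (?e * T) + upper_const))"
    using exp_ereal_mono[OF \<alpha>(4)] by simp
  finally have "ereal (real N powr (1 / dim)) * geom_mean_error N \<mu> \<le>
      ereal (real N powr (1 / dim)) * ereal (exp (- (?e * T) + upper_const))"
    by (rule ereal_mult_left_mono) simp
  also have "\<dots> = ereal (exp (?e * ln heavy_const + upper_const))"
    using pos by (simp add: powr_dim T' algebra_simps flip: exp_add)
  finally show ?thesis .
qed

lemma lower_coeff_pos: "0 < lower_quantization_coeff dim \<mu>"
proof -
  have "ereal (exp (- lower_const)) \<le> lower_quantization_coeff dim \<mu>"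
    unfolding lower_quantization_coeff_def
    by (intro Liminf_bounded eventually_mono[OF eventually_ge_at_top[of 1]] scaled_error_ge)
  then show ?thesis by (rule less_le_trans[rotated]) simp
qed

lemma upper_coeff_finite: "upper_quantization_coeff dim \<mu> < \<infinity>"
proof -
  have "eventually (\<lambda>N. heavy_const \<le> real N) sequentially"
    using filterlim_real_sequentially unfolding filterlim_at_top by blast
  then have "upper_quantization_coeff dim \<mu> \<le> ereal (exp (ln (real m) / entropy_rate * ln heavy_const + upper_const))"
    unfolding upper_quantization_coeff_def
    by (intro Limsup_bounded eventually_mono[OF _ scaled_error_le])
  then show ?thesis by (rule le_less_trans) simp
qed

lemma lower_le_upper_coeff: "lower_quantization_coeff s \<mu> \<le> upper_quantization_coeff s \<mu>"
  unfolding lower_quantization_coeff_def upper_quantization_coeff_def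
  by (rule Liminf_le_Limsup) simp

end

theorem theorem1p1:
  fixes n m :: nat
    and G :: "(nat \<times> nat) set"
    and p :: "nat \<Rightarrow> nat \<Rightarrow> real"
    and \<mu> :: "(real \<times> real) measure"
  assumes "m \<ge> 3" and "n \<ge> m"
    and "G \<subseteq> {0..n - 1} \<times> {0..m - 1}"
    and "card G \<ge> 2"
    and "\<And>i1 j1 i2 j2. (i1, j1) \<in> G \<Longrightarrow> (i2, j2) \<in> G \<Longrightarrow> (i1, j1) \<noteq> (i2, j2) \<Longrightarrow>
           max \<bar>int i1 - int i2\<bar> \<bar>int j1 - int j2\<bar> \<ge> 2"
    and "\<And>i j. (i, j) \<in> G \<Longrightarrow> p i j > 0"
    and "(\<Sum>(i, j)\<in>G. p i j) = 1"
    and "self_affine_measure n m G p \<mu>"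
  shows "0 < lower_quantization_coeff (carpet_dim n m G p) \<mu> \<and>
         lower_quantization_coeff (carpet_dim n m G p) \<mu> \<le>
           upper_quantization_coeff (carpet_dim n m G p) \<mu> \<and>
         upper_quantization_coeff (carpet_dim n m G p) \<mu> < \<infinity>"
proof -
  define P where "P = (\<lambda>g. p (fst g) (snd g))"
  \<comment> \<open>Both \<open>n\<close> and \<open>m\<close> are positive, so the subtraction of
    naturals is exact.\<close>
  have digits: "{0..n - 1} \<times> {0..m - 1} = {..<n} \<times> {..<m}"
    using assms(1,2) by auto
  interpret carpet_measure n m G P \<mu>
  proof (intro carpet_measure.intro carpet.intro carpet_measure_axioms.intro)
    show "G \<subseteq> {..<n} \<times> {..<m}" using assms(3) unfolding digits .
    show "0 < P g" if "g \<in> G" for g using assms(6)[of "fst g" "snd g"] that by (simp add: P_def)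
    show "sum P G = 1" using assms(7) by (simp add: P_def case_prod_beta)
    show "measure \<mu> A = (\<Sum>g\<in>G. P g * measure (distr \<mu> borel (digit_map n m (fst g) (snd g))) A)"
      if "A \<in> sets borel" for A
      using assms(8) that unfolding self_affine_measure_def P_def by (simp add: case_prod_beta)
  qed (use assms(1,2,4,8) in \<open>simp_all add: self_affine_measure_def\<close>)
  have weight: "row_weight G p j = row_mass j" for j
  proof -
    have "row_mass j = sum P ((\<lambda>i. (i, j)) ` row_digits G j)"
      unfolding row_mass_def by (rule sum.cong) (auto simp: row_digits_def)
    also have "\<dots> = row_weight G p j"
      by (subst sum.reindex) (auto simp: inj_on_def row_weight_def P_def)
    finally show ?thesis by simp
  qed
  have cells: "(\<Sum>(i, j)\<in>G. p i j * ln (p i j)) = - cell_entropy"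
    unfolding cell_entropy_def cell_info_def by (simp add: P_def case_prod_beta sum_negf)
  have rows_eq: "rows G = snd ` G" by (force simp: rows_def)
  \<comment> \<open>Digits are grouped by row: \<open>row_info\<close> is constant on a row, and the
    weights there add up to \<open>row_weight\<close>.\<close>
  have "row_entropy = (\<Sum>j\<in>snd ` G. \<Sum>g | g \<in> G \<and> snd g = j. P g * row_info g)"
    unfolding row_entropy_def using sum.image_gen[OF fin, of "\<lambda>g. P g * row_info g" snd] .
  also have "\<dots> = (\<Sum>j\<in>snd ` G. - (row_weight G p j * ln (row_weight G p j)))"
  proof (rule sum.cong[OF refl])
    fix j
    have "(\<Sum>g | g \<in> G \<and> snd g = j. P g * row_info g) =
        (\<Sum>g | g \<in> G \<and> snd g = j. P g * (- ln (row_mass j)))"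
      by (rule sum.cong) (auto simp: row_info_def)
    also have "\<dots> = row_mass j * (- ln (row_mass j))"
      unfolding row_mass_def by (rule sum_distrib_right[symmetric])
    finally show "(\<Sum>g | g \<in> G \<and> snd g = j. P g * row_info g) =
        - (row_weight G p j * ln (row_weight G p j))" by (simp add: weight)
  qed
  finally have rows: "(\<Sum>j\<in>rows G. row_weight G p j * ln (row_weight G p j)) = - row_entropy"
    by (simp add: rows_eq sum_negf)
  have "carpet_dim n m G p = dim"
    unfolding carpet_dim_def cells rows dim_def entropy_rate_def carpet_exponent_def theta_def[symmetric]
    using ln_m_pos by (simp add: field_simps)
  then show ?thesis
    using lower_coeff_pos lower_le_upper_coeff upper_coeff_finite by simp
qed

end
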